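(* For each integer $n\ge 1$, the normalized volume of $\Sigma(\Gamma(n+1))$ is \[ 2^n \sum_{k=0}^n (k+1)\binom{n}{k}\binom{k}{\lfloor k/2\rfloor}. \]
   Context: For $n \ge 1$, $\Gamma(n+1)$ is the graph on the $2n+1$ vertices $u_1,v_1,u_2,v_2,\dots,u_n,v_n,u_{n+1}$ with edges $u_iu_{i+1}$, $u_iv_i$, $v_iu_{i+1}$ for $i=1,\dots,n$, together with the edge $u_1u_{n+1}$. (For $n=1$ the edge $u_1u_{n+1}$ is parallel to $u_1u_2$; this does not affect the polytope below.) For a graph $G=(V,E)$, the symmetric edge polytope is $\Sigma(G) = \operatorname{conv}\{\pm(e_i - e_j) \in \mathbb{R}^V \mid ij \in E\}$, where $e_i$ are the standard basis vectors. The normalized volume of a lattice polytope $P\subset\mathbb{R}^N$ is $(\dim P)!$ times its volume measured with respect to the lattice $\mathbb{Z}^N\cap \operatorname{aff}(P)$ (so that a unimodular simplex has normalized volume $1$). Equivalently, it is $h^*(P;1)$, where the polynomial $h^*(P;t)$ is defined by $1+\sum_{m \ge 1} |mP\cap\mathbb{Z}^N| t^m = h^*(P;t)/(1-t)^{\dim P + 1}$. *)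

theory Defs
  imports "HOL-Analysis.Analysis"
begin

text \<open>
  A graph has the elements of a finite type \<open>'v\<close> as its vertices, so that \<open>real^'v\<close> is its
  ambient space; edges are unordered pairs \<open>{i, j}\<close>, and parallel edges are identified.
\<close>

definition symmetric_edge_polytope :: "'v::finite set set \<Rightarrow> (real^'v) set" where
  "symmetric_edge_polytope E =
     convex hull (\<Union>i. \<Union>j\<in>{j. {i, j} \<in> E}. {axis i 1 - axis j 1, - (axis i 1 - axis j 1)})"

text \<open>
  Edge set of the graph \<open>\<Gamma>(n+1)\<close> on the vertices \<open>u 1, v 1, \<dots>, u n, v n, u (n+1)\<close>. The values
  of \<open>u\<close> and \<open>v\<close> outside \<open>{1..n+1}\<close> and \<open>{1..n}\<close> play no role.
\<close>

definition Gamma_edges :: "nat \<Rightarrow> (nat \<Rightarrow> 'v) \<Rightarrow> (nat \<Rightarrow> 'v) \<Rightarrow> 'v set set" where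
  "Gamma_edges n u v =
     (\<Union>i\<in>{1..n}. {{u i, u (i + 1)}, {u i, v i}, {v i, u (i + 1)}}) \<union> {{u 1, u (n + 1)}}"

definition integer_lattice :: "(real^'v) set" where
  "integer_lattice = {x. \<forall>i. x $ i \<in> \<int>}"

text \<open>
  The map \<open>x \<mapsto> p + (\<Sum>i<d. x i *\<^sub>R b i)\<close>, with \<open>d\<close> the dimension of \<open>P\<close>, identifies
  the pair \<open>\<int>\<^sup>d \<subseteq> \<real>\<^sup>d\<close> with the pair formed by the lattice \<open>integer_lattice \<inter> affine hull P\<close>
  and the space \<open>affine hull P\<close>.
\<close>

definition lattice_frame :: "(real^'v::finite) set \<Rightarrow> (real^'v) \<Rightarrow> (nat \<Rightarrow> real^'v) \<Rightarrow> bool" where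
  "lattice_frame P p b \<longleftrightarrow>
     (let d = nat (aff_dim P) in
        inj_on b {..<d} \<and> independent (b ` {..<d}) \<and>
        range (\<lambda>c :: nat \<Rightarrow> int. p + (\<Sum>i<d. of_int (c i) *\<^sub>R b i))
          = integer_lattice \<inter> affine hull P)"

text \<open>
  Volume with respect to the lattice \<open>integer_lattice \<inter> affine hull P\<close>: Lebesgue measure on
  \<open>\<real>\<^sup>d\<close>, with points of \<open>\<real>\<^sup>d\<close> given as extensional functions on \<open>{..<d}\<close>, in the
  coordinates of a lattice frame. Two frames differ by an affine unimodular map, so the value does
  not depend on the choice. A frame exists for every nonempty lattice polytope; the value is
  meaningful only if a frame exists.
\<close>

definition frame_volume :: "(real^'v::finite) set \<Rightarrow> (real^'v) \<Rightarrow> (nat \<Rightarrow> real^'v) \<Rightarrow> real" where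
  "frame_volume P p b =
     (let d = nat (aff_dim P) in
        measure (Pi\<^sub>M {..<d} (\<lambda>_. lborel))
          {x \<in> {..<d} \<rightarrow>\<^sub>E UNIV. p + (\<Sum>i<d. x i *\<^sub>R b i) \<in> P})"

definition lattice_volume :: "(real^'v::finite) set \<Rightarrow> real" where
  "lattice_volume P = (case SOME (p, b). lattice_frame P p b of (p, b) \<Rightarrow> frame_volume P p b)"

definition normalized_volume :: "(real^'v::finite) set \<Rightarrow> real" where
  "normalized_volume P = fact (nat (aff_dim P)) * lattice_volume P"

end

theory Submission
  imports Defs
begin

text \<open>
  The gauge of a symmetric edge polytope at a point \<open>x\<close> is the least cost of a flow with divergence
  \<open>x\<close>, and the normalized volume of a \<open>d\<close>-dimensional body with gauge \<open>G\<close> is the integral of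
  \<open>exp (- G)\<close>, since \<open>{G \<le> t}\<close> has volume \<open>t ^ d\<close> times that of the body. For \<open>\<Gamma>(n+1)\<close> the
  flows with given divergence have one parameter \<open>c\<close> left after each triangle has been optimized,
  the amount on the edge \<open>u 1 u (n+1)\<close>, and the cost \<open>h\<close> is convex and piecewise linear in \<open>c\<close>.
  Hence \<open>exp (- min h)\<close> is the integral over \<open>c\<close> of the positive part of \<open>h' exp (- h)\<close>.
  Exchanging the integrals and translating all coordinates by \<open>c\<close>, the exponential becomes a
  product over the triangles, while \<open>h'\<close> becomes \<open>sgn c\<close> plus one term in \<open>{-1, 0, 1}\<close> for each
  triangle, each value carrying mass \<open>2\<close>. What remains is the sum of \<open>max 0 (m + 1) + max 0 (m - 1)\<close> over the end
  points \<open>m\<close> of all \<open>n\<close>-step paths with steps in \<open>{-1, 0, 1}\<close>; sorting the paths by their number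
  \<open>k\<close> of nonzero steps turns it into a partial row sum of binomial coefficients.
\<close>

section \<open>Paths with steps in \<open>{-1, 0, 1}\<close>\<close>

text \<open>Sums \<open>\<phi>\<close> over the end points of all \<open>n\<close>-step paths from
  \<open>0\<close> with steps in {-1, 0, 1}. Each step is absorbed into \<open>\<phi>\<close>, which
  matches integrating out the last triangle.\<close>

fun spread :: "nat \<Rightarrow> (int \<Rightarrow> nat) \<Rightarrow> nat" where
  "spread 0 \<phi> = \<phi> 0"
| "spread (Suc n) \<phi> = spread n (\<lambda>m. \<phi> (m + 1) + \<phi> m + \<phi> (m - 1))"

text \<open>Pascal's rule in summed form. It serves twice in the next proof: for the choice of the
  nonzero steps and for the choice of their signs.\<close>

lemma sum_choose_Suc:
  fixes f :: "nat \<Rightarrow> 'a::comm_semiring_1"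
  shows "(\<Sum>k\<le>Suc n. of_nat (Suc n choose k) * f k) = (\<Sum>k\<le>n. of_nat (n choose k) * (f k + f (Suc k)))"
proof -
  have "(\<Sum>k\<le>Suc n. of_nat (Suc n choose k) * f k) =
      f 0 + (\<Sum>k\<le>n. of_nat (Suc n choose Suc k) * f (Suc k))"
    by (subst sum.atMost_Suc_shift) simp
  also have "\<dots> = (f 0 + (\<Sum>k\<le>n. of_nat (n choose Suc k) * f (Suc k))) + (\<Sum>k\<le>n. of_nat (n choose k) * f (Suc k))"
    by (simp add: sum.distrib algebra_simps)
  also have "f 0 + (\<Sum>k\<le>n. of_nat (n choose Suc k) * f (Suc k)) = (\<Sum>k\<le>Suc n. of_nat (n choose k) * f k)"
    by (subst sum.atMost_Suc_shift) simp
  also have "\<dots> = (\<Sum>k\<le>n. of_nat (n choose k) * f k)" by (simp add: binomial_eq_0)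
  finally show ?thesis by (simp add: sum.distrib algebra_simps)
qed

text \<open>Sort the paths: \<open>k\<close> is the number of nonzero steps, and \<open>j\<close> is
  the number of those that go down.\<close>

lemma spread_eq_sum:
  "spread n \<phi> = (\<Sum>k\<le>n. (n choose k) * (\<Sum>j\<le>k. (k choose j) * \<phi> (int k - 2 * int j)))"
proof (induction n arbitrary: \<phi>)
  case (Suc n)
  let ?B = "\<lambda>k. \<Sum>j\<le>k. (k choose j) * \<phi> (int k - 2 * int j)"
  \<comment> \<open>A zero step keeps the row \<open>k\<close> of signed paths; a step up or down
    leads to the row \<open>k + 1\<close>.\<close>
  have "(\<Sum>j\<le>k. (k choose j) * (\<phi> (int k - 2 * int j + 1) + \<phi> (int k - 2 * int j) + \<phi> (int k - 2 * int j - 1))) =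
     ?B k + ?B (Suc k)" for k
    using sum_choose_Suc[of k "\<lambda>j. \<phi> (int (Suc k) - 2 * int j)"]
    by (simp add: algebra_simps sum.distrib)
  then show ?case
    using sum_choose_Suc[of n ?B] by (simp add: Suc.IH)
qed simp

text \<open>The sum telescopes: \<open>(k choose j) * (k - 2 * j)\<close> is
  \<open>(j + 1) * (k choose (j + 1)) - j * (k choose j)\<close>.\<close>

lemma partial_row_sum:
  "(\<Sum>j\<le>m. int (k choose j) * (int k - 2 * int j)) = int (Suc m * (k choose Suc m))"
proof -
  have "real_of_int (\<Sum>j\<le>m. int (k choose j) * (int k - 2 * int j)) =
      2 * (\<Sum>j\<le>m. (real k gchoose j) * (real k / 2 - of_nat j))"
    by (simp add: sum_distrib_left binomial_gbinomial algebra_simps)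
  also have "\<dots> = real_of_int (int (Suc m * (k choose Suc m)))"
    by (subst gbinomial_partial_row_sum) (simp add: binomial_gbinomial algebra_simps)
  finally show ?thesis by (simp only: of_int_eq_iff)
qed

lemma sum_choose_parts:
  "(\<Sum>j\<le>k. (k choose j) * (nat (int k - 2 * int j + 1) + nat (int k - 2 * int j - 1))) =
    (k + 1) * (k choose (k div 2))"
proof -
  \<comment> \<open>At \<open>m = k - 2 * j\<close> the weight
    \<open>nat (m + 1) + nat (m - 1)\<close> is \<open>2 * m\<close> for \<open>m > 0\<close>,
    \<open>1\<close> for \<open>m = 0\<close> and \<open>0\<close> for \<open>m < 0\<close>.\<close>
  have *: "int (\<Sum>j\<le>k. (k choose j) * (nat (int k - 2 * int j + 1) + nat (int k - 2 * int j - 1))) =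
      (\<Sum>j\<le>k div 2. int (k choose j) * (if 2 * j = k then 1 else 2 * (int k - 2 * int j)))"
  proof -
    have "(\<Sum>j\<le>k. (k choose j) * (nat (int k - 2 * int j + 1) + nat (int k - 2 * int j - 1))) =
      (\<Sum>j\<le>k div 2. (k choose j) * (nat (int k - 2 * int j + 1) + nat (int k - 2 * int j - 1)))"
      by (rule sum.mono_neutral_right) auto
    then show ?thesis by (auto intro!: sum.cong)
  qed
  show ?thesis
  proof (cases "even k")
    case True
    then obtain m where k: "k = 2 * m" by blast
    \<comment> \<open>The middle term \<open>j = m\<close> vanishes in the linear sum, so its weight
      \<open>1\<close> is restored as \<open>k choose m\<close>.\<close>
    have "(\<Sum>j\<le>k div 2. int (k choose j) * (if 2 * j = k then 1 else 2 * (int k - 2 * int j))) =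
       2 * (\<Sum>j\<le>m. int (k choose j) * (int k - 2 * int j)) + int (k choose m)"
      by (cases m) (simp_all add: k sum_distrib_left algebra_simps)
    also have "\<dots> = int ((k + 1) * (k choose m))"
    proof -
      \<comment> \<open>Absorption gives \<open>(k - m) * (k choose m)\<close>, and
        \<open>k - m = m\<close>.\<close>
      have "Suc m * (k choose Suc m) = m * (k choose m)"
        by (metis k mult_2 add_diff_cancel_right' binomial_absorb_comp binomial_absorption Suc_times_binomial_eq times_binomial_minus1_eq binomial_symmetric)
      then show ?thesis by (simp only: partial_row_sum) (simp add: k algebra_simps)
    qed
    finally show ?thesis using * by (simp only: of_nat_eq_iff) (simp add: k)
  next
    case False
    then obtain m where k: "k = 2 * m + 1" by (auto elim: oddE)
    have "(\<Sum>j\<le>k div 2. int (k choose j) * (if 2 * j = k then 1 else 2 * (int k - 2 * int j))) =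
       2 * (\<Sum>j\<le>m. int (k choose j) * (int k - 2 * int j))"
      unfolding sum_distrib_left by (rule sum.cong) (auto simp: k)
    \<comment> \<open>Here \<open>m\<close> and \<open>m + 1\<close> are the two central positions,
      so their coefficients agree, and \<open>2 * (m + 1) = k + 1\<close>.\<close>
    also have "\<dots> = int ((k + 1) * (k choose m))"
      using binomial_symmetric[of m k]
      by (simp only: partial_row_sum) (simp add: k algebra_simps)
    finally show ?thesis using * by (simp only: of_nat_eq_iff) (simp add: k)
  qed
qed

lemma spread_parts:
  "spread n (\<lambda>m. nat (m + 1) + nat (m - 1)) = (\<Sum>k\<le>n. (k + 1) * (n choose k) * (k choose (k div 2)))"
  by (simp only: spread_eq_sum sum_choose_parts) (simp add: algebra_simps)

section \<open>Lebesgue measure on finite products\<close>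

interpretation lborel_PiM: product_sigma_finite "\<lambda>_::'i. lborel :: real measure" ..

text \<open>The one-dimensional substitution is applied coordinate by coordinate. With
  \<open>t = 0\<close> the result dilates level sets; with \<open>c = 1\<close> it
  translates.\<close>

lemma nn_integral_PiM_lborel_affine:
  fixes f :: "('i \<Rightarrow> real) \<Rightarrow> ennreal"
  assumes "finite I" "f \<in> borel_measurable (PiM I (\<lambda>_. lborel))" "c > 0"
  shows "(\<integral>\<^sup>+x. f x \<partial>PiM I (\<lambda>_. lborel)) =
    ennreal (c ^ card I) * (\<integral>\<^sup>+x. f (\<lambda>i\<in>I. t i + c * x i) \<partial>PiM I (\<lambda>_. lborel))"
  using assms(1,2)
proof (induction I arbitrary: f)
  case empty
  then show ?case by (simp add: PiM_empty nn_integral_count_space_finite restrict_def)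
next
  case (insert i I)
  note f[measurable] = insert.prems
  have F: "(\<lambda>x. \<integral>\<^sup>+y. f (x(i := y)) \<partial>lborel) \<in> borel_measurable (PiM I (\<lambda>_. lborel))"
    by measurable
  have inner: "(\<integral>\<^sup>+y. f (x(i := y)) \<partial>lborel) =
      ennreal c * (\<integral>\<^sup>+y. f (x(i := t i + c * y)) \<partial>lborel)" if "x \<in> space (PiM I (\<lambda>_. lborel))" for x
  proof -
    have "(\<lambda>y. f (x(i := y))) \<in> borel_measurable borel"
      using that by measurable
    from nn_integral_real_affine[OF this, of c "t i"] show ?thesis
      using \<open>c > 0\<close> by simp
  qed
  have "(\<integral>\<^sup>+x. f x \<partial>PiM (insert i I) (\<lambda>_. lborel)) =
      (\<integral>\<^sup>+x. (\<integral>\<^sup>+y. f (x(i := y)) \<partial>lborel) \<partial>PiM I (\<lambda>_. lborel))"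
    by (rule lborel_PiM.product_nn_integral_insert[OF insert.hyps f])
  also have "\<dots> = ennreal (c ^ card I) *
      (\<integral>\<^sup>+x. (\<integral>\<^sup>+y. f ((\<lambda>j\<in>I. t j + c * x j)(i := y)) \<partial>lborel) \<partial>PiM I (\<lambda>_. lborel))"
    by (rule insert.IH[OF F])
  also have "\<dots> = ennreal (c ^ card I) * (\<integral>\<^sup>+x. ennreal c *
      (\<integral>\<^sup>+y. f ((\<lambda>j\<in>I. t j + c * x j)(i := t i + c * y)) \<partial>lborel) \<partial>PiM I (\<lambda>_. lborel))"
    by (intro arg_cong2[where f = "(*)"] refl nn_integral_cong inner) (auto simp: space_PiM)
  also have "\<dots> = ennreal (c ^ card I) * (\<integral>\<^sup>+x. ennreal c *
      (\<integral>\<^sup>+y. f (\<lambda>j\<in>insert i I. t j + c * (x(i := y)) j) \<partial>lborel) \<partial>PiM I (\<lambda>_. lborel))"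
  proof -
    have "(\<lambda>j\<in>I. t j + c * x j)(i := t i + c * y) =
        (\<lambda>j\<in>insert i I. t j + c * (x(i := y)) j)" for x :: "'i \<Rightarrow> real" and y
      using insert.hyps by auto
    then show ?thesis by simp
  qed
  also have "\<dots> = ennreal (c ^ card I) * (ennreal c * (\<integral>\<^sup>+x.
      (\<integral>\<^sup>+y. f (\<lambda>j\<in>insert i I. t j + c * (x(i := y)) j) \<partial>lborel) \<partial>PiM I (\<lambda>_. lborel)))"
    by (subst nn_integral_cmult) measurable
  also have "\<dots> = ennreal (c ^ card I) * (ennreal c *
      (\<integral>\<^sup>+x. f (\<lambda>j\<in>insert i I. t j + c * x j) \<partial>PiM (insert i I) (\<lambda>_. lborel)))"
  proof -
    have "(\<lambda>x. \<lambda>j\<in>insert i I. t j + c * x j)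
        \<in> PiM (insert i I) (\<lambda>_. lborel) \<rightarrow>\<^sub>M PiM (insert i I) (\<lambda>_. lborel)"
      by (intro measurable_restrict) measurable
    from lborel_PiM.product_nn_integral_insert[OF insert.hyps measurable_compose[OF this f]]
    show ?thesis by (simp only:)
  qed
  also have "ennreal (c ^ card I) * (ennreal c * i') = ennreal (c ^ card (insert i I)) * i'" for i'
    using insert.hyps \<open>c > 0\<close> by (simp add: ennreal_mult mult_ac)
  finally show ?case .
qed

lemma nn_integral_PiM_lborel_translate:
  fixes f :: "('i \<Rightarrow> real) \<Rightarrow> ennreal"
  assumes "finite I" "f \<in> borel_measurable (PiM I (\<lambda>_. lborel))"
  shows "(\<integral>\<^sup>+x. f (\<lambda>i\<in>I. x i + t i) \<partial>PiM I (\<lambda>_. lborel)) = (\<integral>\<^sup>+x. f x \<partial>PiM I (\<lambda>_. lborel))"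
  using nn_integral_PiM_lborel_affine[OF assms, of 1 t] by (simp add: add.commute)

lemma tendsto_neg_exp_neg_at_top: "((\<lambda>t::real. - exp (-t)) \<longlongrightarrow> 0) at_top"
  using tendsto_minus[OF filterlim_compose[OF exp_at_bot filterlim_uminus_at_bot_at_top]] by simp

lemma nn_integral_exp_tail: "(\<integral>\<^sup>+x. ennreal (exp (- x)) * indicator {a..} x \<partial>lborel) = ennreal (exp (- a))"
proof -
  have "(\<integral>\<^sup>+x. ennreal (exp (- x)) * indicator {a..} x \<partial>lborel) = ennreal (0 - (- exp (- a)))"
    by (rule nn_integral_FTC_atLeast[where F = "\<lambda>t. - exp (-t)"])
       (auto intro!: derivative_eq_intros tendsto_neg_exp_neg_at_top)
  then show ?thesis by simp
qed

text \<open>Layer-cake argument: \<open>exp (- G x)\<close> is the integral of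
  \<open>exp (- t)\<close> over \<open>t \<ge> G x\<close>. After exchanging the integrals, the
  level set at \<open>t\<close> contributes \<open>t ^ card I\<close> times the volume of the unit
  ball, and the Gamma integral produces the factorial.\<close>

lemma nn_integral_exp_gauge:
  fixes G :: "('i \<Rightarrow> real) \<Rightarrow> real"
  assumes I: "finite I" and G[measurable]: "G \<in> borel_measurable (PiM I (\<lambda>_. lborel))"
    and nonneg: "\<And>x. G x \<ge> 0"
    and homogeneous: "\<And>x r. r > 0 \<Longrightarrow> G (\<lambda>i\<in>I. r * x i) = r * G x"
  shows "(\<integral>\<^sup>+x. ennreal (exp (- G x)) \<partial>PiM I (\<lambda>_. lborel)) =
    ennreal (fact (card I)) * emeasure (PiM I (\<lambda>_. lborel)) {x \<in> space (PiM I (\<lambda>_. lborel)). G x \<le> 1}"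
proof -
  let ?M = "PiM I (\<lambda>_. lborel :: real measure)"
  interpret sigma_finite_measure ?M by (rule lborel_PiM.sigma_finite[OF I])
  interpret pair_sigma_finite ?M "lborel :: real measure" ..
  define V where "V = emeasure ?M {x \<in> space ?M. G x \<le> 1}"
  have exp_tail: "ennreal (exp (- G x)) = (\<integral>\<^sup>+t. ennreal (exp (-t)) * indicator {G x..} t \<partial>lborel)" for x
    by (simp add: nn_integral_exp_tail)
  have level: "(\<integral>\<^sup>+x. indicator {x. G x \<le> t} x \<partial>?M) = ennreal (t ^ card I) * V" if "t > 0" for t
  proof -
    have "(\<integral>\<^sup>+x. indicator {x. G x \<le> t} x \<partial>?M) = ennreal (t ^ card I) *
        (\<integral>\<^sup>+x. indicator {x. G x \<le> t} (\<lambda>i\<in>I. 0 + t * x i) \<partial>?M)"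
      by (rule nn_integral_PiM_lborel_affine[OF I _ \<open>t > 0\<close>]) measurable
    also have "(\<integral>\<^sup>+x. indicator {x. G x \<le> t} (\<lambda>i\<in>I. 0 + t * x i) \<partial>?M) =
        (\<integral>\<^sup>+x. indicator {x \<in> space ?M. G x \<le> 1} x \<partial>?M)"
      using that by (intro nn_integral_cong) (auto simp: homogeneous indicator_def field_simps)
    also have "\<dots> = V"
      unfolding V_def by (rule nn_integral_indicator) measurable
    finally show ?thesis .
  qed
  have "(\<integral>\<^sup>+x. ennreal (exp (- G x)) \<partial>?M) =
      (\<integral>\<^sup>+x. (\<integral>\<^sup>+t. ennreal (exp (-t)) * indicator {G x..} t \<partial>lborel) \<partial>?M)"
    by (simp only: exp_tail)
  also have "\<dots> = (\<integral>\<^sup>+x. (\<integral>\<^sup>+t. ennreal (exp (-t)) * (if G x \<le> t then 1 else 0) \<partial>lborel) \<partial>?M)"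
    by (simp add: indicator_def of_bool_def)
  also have "\<dots> = (\<integral>\<^sup>+t. (\<integral>\<^sup>+x. ennreal (exp (-t)) * (if G x \<le> t then 1 else 0) \<partial>?M) \<partial>lborel)"
    by (rule Fubini'[symmetric]) measurable
  also have "\<dots> = (\<integral>\<^sup>+t. ennreal (exp (-t)) * (\<integral>\<^sup>+x. indicator {x. G x \<le> t} x \<partial>?M) \<partial>lborel)"
    by (subst nn_integral_cmult[symmetric]) (auto simp: indicator_def intro!: nn_integral_cong)
  \<comment> \<open>Homogeneity covers \<open>t > 0\<close>, levels below \<open>0\<close> are
    empty, and \<open>t = 0\<close> is a null set.\<close>
  also have "\<dots> = (\<integral>\<^sup>+t. ennreal (t ^ card I * exp (-t)) * indicator {0..} t * V \<partial>lborel)"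
  proof (rule nn_integral_cong_AE, rule AE_mp[OF AE_lborel_singleton[of 0]], intro AE_I2 impI)
    fix t :: real assume "t \<noteq> 0"
    consider "t > 0" | "t < 0" using \<open>t \<noteq> 0\<close> by linarith
    then show "ennreal (exp (-t)) * (\<integral>\<^sup>+x. indicator {x. G x \<le> t} x \<partial>?M) =
        ennreal (t ^ card I * exp (-t)) * indicator {0..} t * V"
    proof cases
      case 1
      then show ?thesis by (simp add: level ennreal_mult mult_ac)
    next
      case 2
      then have "\<not> G x \<le> t" for x using nonneg[of x] by linarith
      then show ?thesis using 2 by simp
    qed
  qed
  also have "\<dots> = (\<integral>\<^sup>+t. ennreal (t ^ card I * exp (-t)) * indicator {0..} t \<partial>lborel) * V"
    by (rule nn_integral_multc) measurable
  also have "(\<integral>\<^sup>+t. ennreal (t ^ card I * exp (-t)) * indicator {0..} t \<partial>lborel) = ennreal (fact (card I))"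
  proof -
    have "((\<lambda>t. t powr (real (Suc (card I)) - 1) / exp t) has_integral Gamma (real (Suc (card I)))) {0..}"
      by (rule Gamma_integral_real) simp
    from nn_integral_has_integral_lebesgue[OF _ this]
    have "(\<integral>\<^sup>+t. ennreal (indicator {0..} t * (t powr real (card I) / exp t)) \<partial>lborel) = ennreal (fact (card I))"
      using Gamma_fact[of "card I", where 'a = real] by (simp add: add.commute)
    \<comment> \<open>At \<open>t = 0\<close> with exponent \<open>0\<close>, \<open>powr\<close>
      yields \<open>0\<close> but \<open>^\<close> yields \<open>1\<close>; hence equality almost
      everywhere only.\<close>
    moreover have "(\<integral>\<^sup>+t. ennreal (indicator {0..} t * (t powr real (card I) / exp t)) \<partial>lborel) =
       (\<integral>\<^sup>+t. ennreal (t ^ card I * exp (-t)) * indicator {0..} t \<partial>lborel)"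
      by (rule nn_integral_cong_AE, rule AE_mp[OF AE_lborel_singleton[of 0]], intro AE_I2 impI)
         (auto simp: indicator_def powr_realpow exp_minus field_simps)
    ultimately show ?thesis by simp
  qed
  finally show ?thesis unfolding V_def .
qed

section \<open>Independence of the lattice frame\<close>

lemma borel_measurable_PiM_linear:
  fixes b :: "'i \<Rightarrow> 'a::euclidean_space"
  shows "(\<lambda>x. \<Sum>i\<in>I. x i *\<^sub>R b i) \<in> borel_measurable (PiM I (\<lambda>_. lborel))"
  by (intro borel_measurable_sum borel_measurable_scaleR borel_measurable_const
        measurable_component_singleton[THEN measurable_compose, OF _ measurable_ident_sets]) auto

lemma independent_sum_unique:
  fixes b :: "nat \<Rightarrow> 'a::real_vector"
  assumes "inj_on b {..<d}" "independent (b ` {..<d})"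
    and eq: "(\<Sum>i<d. x i *\<^sub>R b i) = (\<Sum>i<d. y i *\<^sub>R b i)" and "i < d"
  shows "x i = y i"
proof -
  have "(\<Sum>v\<in>b ` {..<d}. (x (the_inv_into {..<d} b v) - y (the_inv_into {..<d} b v)) *\<^sub>R v) =
      (\<Sum>i<d. (x i - y i) *\<^sub>R b i)"
    using assms(1) by (simp add: sum.reindex the_inv_into_f_f)
  also have "\<dots> = 0"
    using eq by (simp add: algebra_simps sum_subtractf)
  finally have "x (the_inv_into {..<d} b (b i)) - y (the_inv_into {..<d} b (b i)) = 0"
    using \<open>i < d\<close> by (intro independentD[OF assms(2)]) auto
  then show ?thesis using assms(1) \<open>i < d\<close> by (simp add: the_inv_into_f_f)
qed

text \<open>Extensional coefficient vectors form a countable set and, for independent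
  \<open>b\<close>, parametrize the lattice injectively; arbitrary functions from \<open>nat\<close>
  to \<open>int\<close> do neither.\<close>

lemma range_int_combination:
  fixes b :: "nat \<Rightarrow> 'a::real_vector"
  shows "range (\<lambda>c :: nat \<Rightarrow> int. p + (\<Sum>i<d. of_int (c i) *\<^sub>R b i)) =
    (\<lambda>c. p + (\<Sum>i<d. of_int (c i) *\<^sub>R b i)) ` ({..<d} \<rightarrow>\<^sub>E (UNIV :: int set))"
proof -
  have "p + (\<Sum>i<d. of_int (c i) *\<^sub>R b i) \<in>
      (\<lambda>c. p + (\<Sum>i<d. of_int (c i) *\<^sub>R b i)) ` ({..<d} \<rightarrow>\<^sub>E (UNIV :: int set))" for c :: "nat \<Rightarrow> int"
    by (rule image_eqI[of _ _ "restrict c {..<d}"]) auto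
  then show ?thesis by auto
qed

text \<open>
  Folding the integral over the unit cube of one frame and averaging over the unit cube of the
  other gives an expression that is symmetric in the two frames.
\<close>

lemma nn_integral_fold_frames:
  fixes b b' :: "nat \<Rightarrow> 'a::euclidean_space" and p p' :: 'a and d :: nat
  defines "M \<equiv> PiM {..<d} (\<lambda>_. lborel :: real measure)"
    and "Q \<equiv> {..<d} \<rightarrow>\<^sub>E {0..<1::real}"
  assumes inj: "inj_on b {..<d}" and indep: "independent (b ` {..<d})"
    and L: "range (\<lambda>c :: nat \<Rightarrow> int. p + (\<Sum>i<d. of_int (c i) *\<^sub>R b i)) = L"
    and L': "range (\<lambda>c :: nat \<Rightarrow> int. p' + (\<Sum>i<d. of_int (c i) *\<^sub>R b' i)) = L"
    and f[measurable]: "f \<in> borel_measurable borel"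
  shows "(\<integral>\<^sup>+x. f (p + (\<Sum>i<d. x i *\<^sub>R b i)) \<partial>M) =
    (\<integral>\<^sup>+y. \<integral>\<^sup>+x. indicator Q x * indicator Q y *
      (\<integral>\<^sup>+l. f (l + (\<Sum>i<d. x i *\<^sub>R b i) + (\<Sum>i<d. y i *\<^sub>R b' i)) \<partial>count_space L) \<partial>M \<partial>M)"
proof -
  define V where "V x = (\<Sum>i<d. x i *\<^sub>R b i)" for x
  define V' where "V' x = (\<Sum>i<d. x i *\<^sub>R b' i)" for x
  define Z :: "(nat \<Rightarrow> int) set" where "Z = {..<d} \<rightarrow>\<^sub>E UNIV"
  have [measurable]: "V \<in> borel_measurable M" "V' \<in> borel_measurable M"
    unfolding V_def V'_def M_def by (rule borel_measurable_PiM_linear)+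
  have V_add: "V (\<lambda>i\<in>{..<d}. x i + z i) = V x + V z" for x z
    by (simp add: V_def sum.distrib scaleR_add_left)
  have Q_sets[measurable]: "Q \<in> sets M"
    unfolding M_def Q_def by (rule sets_PiM_I_finite) auto
  have Q_measure: "emeasure M Q = 1"
    unfolding M_def Q_def by (subst lborel_PiM.emeasure_PiM) auto
  have "countable Z"
    unfolding Z_def by (rule countable_PiE) auto
  \<comment> \<open>Both \<open>p'\<close> and \<open>p' + b' j\<close> lie in \<open>L\<close>, so
    their difference is an integer combination of the \<open>b i\<close>.\<close>
  have "\<exists>c :: nat \<Rightarrow> int. b' j = (\<Sum>i<d. of_int (c i) *\<^sub>R b i)" if "j < d" for j
  proof -
    have "p' + (\<Sum>i<d. of_int (if i = j then 1 else 0) *\<^sub>R b' i) \<in> L"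
      unfolding L'[symmetric] by (rule range_eqI[of _ _ "\<lambda>i. if i = j then 1 else 0"]) simp
    moreover have "(\<Sum>i<d. of_int (if i = j then 1 else 0) *\<^sub>R b' i) = b' j"
      using that by (simp add: if_distrib[of of_int] if_distrib[of "\<lambda>c. c *\<^sub>R _"] cong: if_cong)
    ultimately obtain c where c: "p' + b' j = p + (\<Sum>i<d. of_int (c i) *\<^sub>R b i)"
      unfolding L[symmetric] by auto
    have "p' + (\<Sum>i<d. of_int 0 *\<^sub>R b' i) \<in> L"
      unfolding L'[symmetric] by (rule range_eqI[of _ _ "\<lambda>i. 0"]) simp
    then obtain c0 where c0: "p' = p + (\<Sum>i<d. of_int (c0 i) *\<^sub>R b i)"
      unfolding L[symmetric] by auto
    have "b' j = (\<Sum>i<d. of_int (c i - c0 i) *\<^sub>R b i)"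
      using c c0 by (simp add: algebra_simps sum_subtractf)
    then show ?thesis by (rule exI[where x = "\<lambda>i. c i - c0 i"])
  qed
  then obtain B :: "nat \<Rightarrow> nat \<Rightarrow> int" where B: "\<And>j. j < d \<Longrightarrow> b' j = (\<Sum>i<d. of_int (B j i) *\<^sub>R b i)"
    by metis
  \<comment> \<open>A shift by \<open>V' y\<close> is thus a translation in the coordinates of
    \<open>b\<close>, and Lebesgue measure is invariant under it.\<close>
  have V'_V: "V' y = V (\<lambda>i. \<Sum>j<d. y j * of_int (B j i))" for y
  proof -
    have "V' y = (\<Sum>j<d. \<Sum>i<d. (y j * of_int (B j i)) *\<^sub>R b i)"
      by (simp add: V'_def B scaleR_sum_right)
    also have "\<dots> = V (\<lambda>i. \<Sum>j<d. y j * of_int (B j i))"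
      unfolding V_def by (subst sum.swap) (simp add: scaleR_sum_left)
    finally show ?thesis .
  qed
  have bij: "bij_betw (\<lambda>z. p + V (\<lambda>i. of_int (z i))) Z L"
  proof (rule bij_betw_imageI)
    show "inj_on (\<lambda>z. p + V (\<lambda>i. of_int (z i))) Z"
    proof (rule inj_onI)
      fix z w assume "z \<in> Z" "w \<in> Z" "p + V (\<lambda>i. of_int (z i)) = p + V (\<lambda>i. of_int (w i))"
      then show "z = w"
        using independent_sum_unique[OF inj indep, of "\<lambda>i. of_int (z i)" "\<lambda>i. of_int (w i)"]
        unfolding V_def Z_def by (intro PiE_ext) auto
    qed
    show "(\<lambda>z. p + V (\<lambda>i. of_int (z i))) ` Z = L"
      unfolding L[symmetric] range_int_combination by (simp add: V_def Z_def)
  qed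
  \<comment> \<open>The integer translates of the half-open cube \<open>Q\<close> partition the
    space; rounding down finds the one that contains \<open>x\<close>.\<close>
  have tile: "(\<integral>\<^sup>+z. indicator Q (\<lambda>i\<in>{..<d}. x i + - of_int (z i)) \<partial>count_space Z) = 1"
    if "x \<in> space M" for x
  proof -
    let ?z = "\<lambda>i\<in>{..<d}. \<lfloor>x i\<rfloor>"
    have "(\<lambda>i\<in>{..<d}. x i + - of_int (z i)) \<in> Q \<longleftrightarrow> z = ?z" if "z \<in> Z" for z
    proof
      assume "(\<lambda>i\<in>{..<d}. x i + - of_int (z i)) \<in> Q"
      then have "0 \<le> x i - of_int (z i) \<and> x i - of_int (z i) < 1" if "i < d" for i
        using that by (auto simp: Q_def PiE_iff)
      then have "z i = \<lfloor>x i\<rfloor>" if "i < d" for i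
        using that by (smt (verit) floor_unique)
      then show "z = ?z"
        using \<open>z \<in> Z\<close> by (intro PiE_ext[where k="{..<d}" and s="\<lambda>_. UNIV"]) (auto simp: Z_def)
    next
      assume "z = ?z"
      then show "(\<lambda>i\<in>{..<d}. x i + - of_int (z i)) \<in> Q"
        by (auto simp: Q_def) linarith
    qed
    then have "(\<integral>\<^sup>+z. indicator Q (\<lambda>i\<in>{..<d}. x i + - of_int (z i)) \<partial>count_space Z) =
        (\<integral>\<^sup>+z. indicator {?z} z \<partial>count_space Z)"
      by (intro nn_integral_cong) (auto simp: indicator_def)
    also have "\<dots> = 1"
      by (subst nn_integral_indicator) (auto simp: Z_def)
    finally show ?thesis .
  qed
  \<comment> \<open>Shift by \<open>V' y\<close>, cut along the tiling, move every tile back to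
    \<open>Q\<close>, and collect the moves into a sum over \<open>L\<close>. The left side is
    independent of \<open>y\<close>.\<close>
  have fold: "(\<integral>\<^sup>+x. f (p + V x) \<partial>M) =
      (\<integral>\<^sup>+x. indicator Q x * (\<integral>\<^sup>+l. f (l + V x + V' y) \<partial>count_space L) \<partial>M)" for y
  proof -
    have "(\<integral>\<^sup>+x. f (p + V x) \<partial>M) =
        (\<integral>\<^sup>+x. f (p + V (\<lambda>i\<in>{..<d}. x i + (\<Sum>j<d. y j * of_int (B j i)))) \<partial>M)"
      unfolding M_def
      by (rule nn_integral_PiM_lborel_translate[symmetric]) (simp, fold M_def, measurable)
    also have "\<dots> = (\<integral>\<^sup>+x. f (p + V x + V' y) \<partial>M)"
      by (simp only: V_add V'_V add.assoc)
    also have "\<dots> = (\<integral>\<^sup>+x. (\<integral>\<^sup>+z. indicator Q (\<lambda>i\<in>{..<d}. x i + - of_int (z i)) *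
        f (p + V x + V' y) \<partial>count_space Z) \<partial>M)"
      by (intro nn_integral_cong) (subst nn_integral_multc, simp, subst tile, simp_all)
    also have "\<dots> = (\<integral>\<^sup>+z. (\<integral>\<^sup>+x. indicator Q (\<lambda>i\<in>{..<d}. x i + - of_int (z i)) *
        f (p + V x + V' y) \<partial>M) \<partial>count_space Z)"
    proof (rule nn_integral_count_space_nn_integral[OF \<open>countable Z\<close>])
      fix z :: "nat \<Rightarrow> int"
      have "(\<lambda>x. \<lambda>i\<in>{..<d}. x i + - of_int (z i)) \<in> M \<rightarrow>\<^sub>M M"
        unfolding M_def by (intro measurable_restrict) measurable
      note [measurable] = measurable_compose[OF this borel_measurable_indicator[OF Q_sets]]
      show "(\<lambda>x. indicator Q (\<lambda>i\<in>{..<d}. x i + - of_int (z i)) * f (p + V x + V' y))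
          \<in> borel_measurable M"
        by measurable
    qed
    also have "\<dots> = (\<integral>\<^sup>+z. (\<integral>\<^sup>+x. indicator Q x *
        f (p + V (\<lambda>i. of_int (z i)) + V x + V' y) \<partial>M) \<partial>count_space Z)"
    proof (rule nn_integral_cong)
      fix z :: "nat \<Rightarrow> int"
      have "(\<integral>\<^sup>+x. indicator Q x * f (p + V (\<lambda>i. of_int (z i)) + V x + V' y) \<partial>M) =
          (\<integral>\<^sup>+x. indicator Q (\<lambda>i\<in>{..<d}. x i + - of_int (z i)) *
            f (p + V (\<lambda>i. of_int (z i)) + V (\<lambda>i\<in>{..<d}. x i + - of_int (z i)) + V' y) \<partial>M)"
        unfolding M_def
        by (rule nn_integral_PiM_lborel_translate[symmetric]) (simp, fold M_def, measurable)
      moreover have "p + V (\<lambda>i. of_int (z i)) + V (\<lambda>i\<in>{..<d}. x i + - of_int (z i)) = p + V x" for x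
        unfolding V_add by (simp add: V_def sum_negf)
      ultimately show "(\<integral>\<^sup>+x. indicator Q (\<lambda>i\<in>{..<d}. x i + - of_int (z i)) * f (p + V x + V' y) \<partial>M) =
          (\<integral>\<^sup>+x. indicator Q x * f (p + V (\<lambda>i. of_int (z i)) + V x + V' y) \<partial>M)"
        by (simp only:)
    qed
    also have "\<dots> = (\<integral>\<^sup>+x. (\<integral>\<^sup>+z. indicator Q x *
        f (p + V (\<lambda>i. of_int (z i)) + V x + V' y) \<partial>count_space Z) \<partial>M)"
      by (rule nn_integral_count_space_nn_integral[OF \<open>countable Z\<close>, symmetric]) measurable
    also have "\<dots> = (\<integral>\<^sup>+x. indicator Q x * (\<integral>\<^sup>+l. f (l + V x + V' y) \<partial>count_space L) \<partial>M)"
      by (intro nn_integral_cong)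
         (simp add: nn_integral_cmult nn_integral_bij_count_space[OF bij, symmetric])
    finally show ?thesis .
  qed
  \<comment> \<open>\<open>Q\<close> has measure \<open>1\<close>, so averaging over
    \<open>y\<close> in \<open>Q\<close> keeps the value.\<close>
  have "(\<integral>\<^sup>+x. f (p + V x) \<partial>M) = (\<integral>\<^sup>+y. indicator Q y * (\<integral>\<^sup>+x. f (p + V x) \<partial>M) \<partial>M)"
    by (simp add: nn_integral_multc Q_measure)
  also have "\<dots> = (\<integral>\<^sup>+y. \<integral>\<^sup>+x. indicator Q x * indicator Q y *
      (\<integral>\<^sup>+l. f (l + V x + V' y) \<partial>count_space L) \<partial>M \<partial>M)"
  proof (rule nn_integral_cong)
    fix y
    show "indicator Q y * (\<integral>\<^sup>+x. f (p + V x) \<partial>M) = (\<integral>\<^sup>+x. indicator Q x * indicator Q y *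
      (\<integral>\<^sup>+l. f (l + V x + V' y) \<partial>count_space L) \<partial>M)"
      unfolding fold[of y] by (cases "y \<in> Q") simp_all
  qed
  finally show ?thesis
    by (simp only: V_def V'_def)
qed

text \<open>Both sides fold to the same expression up to the order of integration. This yields
  invariance of the volume under change of frame without determinants.\<close>

lemma nn_integral_frame_cong:
  fixes b b' :: "nat \<Rightarrow> 'a::euclidean_space" and p p' :: 'a and d :: nat
  assumes "inj_on b {..<d}" "independent (b ` {..<d})"
    and "inj_on b' {..<d}" "independent (b' ` {..<d})"
    and L: "range (\<lambda>c :: nat \<Rightarrow> int. p + (\<Sum>i<d. of_int (c i) *\<^sub>R b i)) =
      range (\<lambda>c :: nat \<Rightarrow> int. p' + (\<Sum>i<d. of_int (c i) *\<^sub>R b' i))"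
    and f[measurable]: "f \<in> borel_measurable borel"
  shows "(\<integral>\<^sup>+x. f (p + (\<Sum>i<d. x i *\<^sub>R b i)) \<partial>PiM {..<d} (\<lambda>_. lborel)) =
    (\<integral>\<^sup>+x. f (p' + (\<Sum>i<d. x i *\<^sub>R b' i)) \<partial>PiM {..<d} (\<lambda>_. lborel))"
proof -
  define M where "M = PiM {..<d} (\<lambda>_. lborel :: real measure)"
  define L where "L = range (\<lambda>c :: nat \<Rightarrow> int. p + (\<Sum>i<d. of_int (c i) *\<^sub>R b i))"
  define Q where "Q = {..<d} \<rightarrow>\<^sub>E {0..<1::real}"
  interpret sigma_finite_measure M unfolding M_def by (rule lborel_PiM.sigma_finite) simp
  interpret pair_sigma_finite M M ..
  have [measurable]: "Q \<in> sets M"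
    unfolding Q_def M_def by (rule sets_PiM_I_finite) auto
  define V where "V x = (\<Sum>i<d. x i *\<^sub>R b i)" for x
  define V' where "V' x = (\<Sum>i<d. x i *\<^sub>R b' i)" for x
  have [measurable]: "V \<in> borel_measurable M" "V' \<in> borel_measurable M"
    unfolding V_def V'_def M_def by (rule borel_measurable_PiM_linear)+
  have "countable L"
    unfolding L_def range_int_combination by (intro countable_image countable_PiE) auto
  have "(\<integral>\<^sup>+y. \<integral>\<^sup>+x. indicator Q x * indicator Q y *
      (\<integral>\<^sup>+l. f (l + V x + V' y) \<partial>count_space L) \<partial>M \<partial>M) =
    (\<integral>\<^sup>+x. \<integral>\<^sup>+y. indicator Q x * indicator Q y *
      (\<integral>\<^sup>+l. f (l + V x + V' y) \<partial>count_space L) \<partial>M \<partial>M)"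
  proof (rule Fubini')
    \<comment> \<open>Countability of \<open>L\<close> makes its counting measure
      \<open>\<sigma>\<close>-finite, so the lattice sum is jointly measurable in \<open>x\<close>
      and \<open>y\<close>.\<close>
    interpret L: sigma_finite_measure "count_space L"
      using \<open>countable L\<close> by (rule sigma_finite_measure_count_space_countable)
    have [measurable]: "snd \<in> (M \<Otimes>\<^sub>M M) \<Otimes>\<^sub>M count_space L \<rightarrow>\<^sub>M borel"
      by (rule measurable_compose[OF measurable_snd]) simp
    have "(\<lambda>(w, l). f (l + V (fst w) + V' (snd w))) \<in>
        borel_measurable ((M \<Otimes>\<^sub>M M) \<Otimes>\<^sub>M count_space L)"
      by measurable
    from L.borel_measurable_nn_integral[OF this]
    show "(\<lambda>(x, y). indicator Q x * indicator Q y *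
      (\<integral>\<^sup>+l. f (l + V x + V' y) \<partial>count_space L)) \<in>
        borel_measurable (M \<Otimes>\<^sub>M M)"
      by (simp add: case_prod_beta')
  qed
  then show ?thesis
    using nn_integral_fold_frames[OF assms(1,2) refl L[symmetric] f]
      nn_integral_fold_frames[OF assms(3,4) L[symmetric] refl f]
    unfolding L_def Q_def V_def V'_def M_def by (simp add: mult_ac add_ac)
qed

lemma frame_volume_eq_nn_integral:
  assumes P: "P \<in> sets borel"
  shows "frame_volume P p b = enn2real (\<integral>\<^sup>+x. indicator P (p + (\<Sum>i<nat (aff_dim P). x i *\<^sub>R b i))
      \<partial>PiM {..<nat (aff_dim P)} (\<lambda>_. lborel))"
proof -
  define M where "M = PiM {..<nat (aff_dim P)} (\<lambda>_. lborel :: real measure)"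
  define f where "f x = p + (\<Sum>i<nat (aff_dim P). x i *\<^sub>R b i)" for x
  have f[measurable]: "f \<in> borel_measurable M"
    unfolding f_def M_def by (intro borel_measurable_add borel_measurable_const borel_measurable_PiM_linear)
  have "{x \<in> space M. f x \<in> P} \<in> sets M"
    using measurable_sets[OF f P] by (simp add: vimage_def Int_def conj_commute)
  then have "emeasure M {x \<in> space M. f x \<in> P} = (\<integral>\<^sup>+x. indicator {x \<in> space M. f x \<in> P} x \<partial>M)"
    by (rule nn_integral_indicator[symmetric])
  also have "\<dots> = (\<integral>\<^sup>+x. indicator P (f x) \<partial>M)"
    by (intro nn_integral_cong) (auto simp: indicator_def)
  finally show ?thesis
    by (simp add: frame_volume_def measure_def f_def M_def space_PiM Let_def)
qed

text \<open>Removes the choice operator: once some frame exists, the chosen one is a frame too, and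
  all frames give the same volume.\<close>

lemma lattice_volume_eq_frame_volume:
  assumes frame: "lattice_frame P p b" and P: "P \<in> sets borel"
  shows "lattice_volume P = frame_volume P p b"
proof -
  obtain p' b' where some: "(SOME (p, b). lattice_frame P p b) = (p', b')"
    by (metis surj_pair)
  have "lattice_frame P p' b'"
    using someI[of "\<lambda>(p, b). lattice_frame P p b" "(p, b)"] frame some by simp
  then have "frame_volume P p' b' = frame_volume P p b"
    using frame P unfolding frame_volume_eq_nn_integral[OF P] lattice_frame_def Let_def
    by (intro arg_cong[where f = enn2real] nn_integral_frame_cong) auto
  then show ?thesis by (simp add: lattice_volume_def some)
qed

section \<open>The integral of the exponential of the flow cost\<close>

lemma coercive_attains_min:
  fixes h :: "real \<Rightarrow> real"
  assumes cont: "continuous_on UNIV h" and coercive: "\<And>x. \<bar>x\<bar> \<le> h x"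
  obtains x0 where "\<And>x. h x0 \<le> h x"
proof -
  \<comment> \<open>Outside this interval coercivity gives
    \<open>h x \<ge> \<bar>x\<bar> > h 0\<close>, so a minimum over the interval is global.\<close>
  have "0 \<in> {- h 0..h 0}" using coercive[of 0] by simp
  moreover have "continuous_on {- h 0..h 0} h" using cont continuous_on_subset by blast
  ultimately obtain x0 where x0: "x0 \<in> {- h 0..h 0}" "\<And>x. x \<in> {- h 0..h 0} \<Longrightarrow> h x0 \<le> h x"
    using continuous_attains_inf[of "{- h 0..h 0}" h] by auto
  have "h x0 \<le> h x" for x
  proof (cases "x \<in> {- h 0..h 0}")
    case False
    then have "h 0 \<le> h x" using coercive[of x] by auto
    then show ?thesis using x0(2)[OF \<open>0 \<in> _\<close>] by simp
  qed (rule x0)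
  then show thesis by (rule that)
qed

text \<open>
  The integrand is the derivative of \<open>- exp (- h)\<close> to the right of the minimum; to its left it is
  negative and hence truncated to \<open>0\<close>.
\<close>

lemma nn_integral_exp_minimum:
  fixes h h' :: "real \<Rightarrow> real"
  assumes S: "finite S" and cont: "continuous_on UNIV h" and coercive: "\<And>x. \<bar>x\<bar> \<le> h x"
    and deriv: "\<And>x. x \<notin> S \<Longrightarrow> (h has_real_derivative h' x) (at x)"
    and subgradient: "\<And>x y. h x + h' x * (y - x) \<le> h y"
    and [measurable]: "h' \<in> borel_measurable borel"
    and minimum: "\<And>x. h x0 \<le> h x"
  shows "(\<integral>\<^sup>+x. ennreal (h' x * exp (- h x)) \<partial>lborel) = ennreal (exp (- h x0))"
proof -
  \<comment> \<open>The sign of \<open>h'\<close> at \<open>x0\<close> is undetermined; the positive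
    part keeps \<open>g\<close> nonnegative everywhere.\<close>
  define g where "g x = max 0 (h' x) * exp (- h x)" for x
  have [measurable]: "h \<in> borel_measurable borel"
    using cont by (rule borel_measurable_continuous_onI)
  \<comment> \<open>The subgradient inequality from \<open>x\<close> towards the minimum
    \<open>x0\<close> fixes the sign of \<open>h'\<close> on either side.\<close>
  have right: "0 \<le> h' x" if "x > x0" for x
    using subgradient[of x x0] minimum[of x] that by (smt (verit) mult_neg_neg)
  have left: "h' x \<le> 0" if "x < x0" for x
    using subgradient[of x x0] minimum[of x] that by (smt (verit) mult_pos_pos)
  have upto: "(\<integral>\<^sup>+x. ennreal (indicator {x0..x0 + real N} x * g x) \<partial>lborel) =
      ennreal (exp (- h x0) - exp (- h (x0 + real N)))" for N
  proof (rule nn_integral_has_integral_lebesgue)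
    have "(g has_integral (- exp (- h (x0 + real N)) - (- exp (- h x0)))) {x0..x0 + real N}"
    proof (rule fundamental_theorem_of_calculus_strong[of "insert x0 S"])
      show "finite (insert x0 S)" using S by simp
      show "continuous_on {x0..x0 + real N} (\<lambda>x. - exp (- h x))"
        by (intro continuous_intros continuous_on_subset[OF cont]) simp
      fix x assume x: "x \<in> {x0..x0 + real N} - insert x0 S"
      then have "g x = h' x * exp (- h x)" using right[of x] by (simp add: g_def)
      moreover have "((\<lambda>x. - exp (- h x)) has_real_derivative h' x * exp (- h x)) (at x)"
        using x by (auto intro!: derivative_eq_intros deriv)
      ultimately show "((\<lambda>x. - exp (- h x)) has_vector_derivative g x) (at x)"
        by (simp add: has_real_derivative_iff_has_vector_derivative)
    qed simp
    then show "(g has_integral (exp (- h x0) - exp (- h (x0 + real N)))) {x0..x0 + real N}"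
      by simp
  qed (simp add: g_def)
  \<comment> \<open>Let \<open>N\<close> grow: the integrals converge monotonically, and coercivity
    sends the boundary term to \<open>0\<close>.\<close>
  have "(\<lambda>N. \<integral>\<^sup>+x. ennreal (indicator {x0..x0 + real N} x * g x) \<partial>lborel) \<longlonglongrightarrow>
      (\<integral>\<^sup>+x. ennreal (indicator {x0..} x * g x) \<partial>lborel)"
  proof (rule nn_integral_LIMSEQ)
    show "incseq (\<lambda>N x. ennreal (indicator {x0..x0 + real N} x * g x))"
      by (auto simp: incseq_def le_fun_def indicator_def g_def intro!: ennreal_leI)
    show "(\<lambda>x. ennreal (indicator {x0..x0 + real N} x * g x)) \<in> borel_measurable lborel" for N
      unfolding g_def by measurable
    show "(\<lambda>N. ennreal (indicator {x0..x0 + real N} x * g x)) \<longlonglongrightarrow>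
        ennreal (indicator {x0..} x * g x)" for x
    proof (rule tendsto_eventually)
      obtain K where "x - x0 \<le> real K" using real_arch_simple by blast
      then show "\<forall>\<^sub>F N in sequentially. ennreal (indicator {x0..x0 + real N} x * g x) =
          ennreal (indicator {x0..} x * g x)"
        by (intro eventually_sequentiallyI[of K]) (auto simp: indicator_def)
    qed
  qed
  moreover have "(\<lambda>N. ennreal (exp (- h x0) - exp (- h (x0 + real N)))) \<longlonglongrightarrow>
      ennreal (exp (- h x0) - 0)"
  proof (intro tendsto_ennrealI tendsto_diff tendsto_const)
    have "filterlim (\<lambda>N. x0 + real N) at_top sequentially"
      by (intro filterlim_tendsto_add_at_top[OF tendsto_const] filterlim_real_sequentially)
    then have "filterlim (\<lambda>N. h (x0 + real N)) at_top sequentially"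
      by (rule filterlim_at_top_mono) (use coercive abs_le_D1 in \<open>auto intro!: always_eventually\<close>)
    then show "(\<lambda>N. exp (- h (x0 + real N))) \<longlonglongrightarrow> 0"
      by (intro filterlim_compose[OF exp_at_bot] filterlim_compose[OF filterlim_uminus_at_bot_at_top])
  qed
  ultimately have "(\<integral>\<^sup>+x. ennreal (indicator {x0..} x * g x) \<partial>lborel) = ennreal (exp (- h x0))"
    unfolding upto using LIMSEQ_unique by fastforce
  also have "(\<integral>\<^sup>+x. ennreal (indicator {x0..} x * g x) \<partial>lborel) =
      (\<integral>\<^sup>+x. ennreal (h' x * exp (- h x)) \<partial>lborel)"
  proof (rule nn_integral_cong_AE, rule AE_mp[OF AE_lborel_singleton[of x0]], intro AE_I2 impI)
    fix x assume "x \<noteq> x0"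
    then consider "x > x0" | "x < x0" by linarith
    then show "ennreal (indicator {x0..} x * g x) = ennreal (h' x * exp (- h x))"
    proof cases
      case 1
      then show ?thesis using right[of x] by (simp add: g_def)
    next
      case 2
      then have "h' x * exp (- h x) \<le> 0" using left[of x] by (simp add: mult_le_0_iff)
      then show ?thesis using 2 by (simp add: ennreal_neg)
    qed
  qed
  finally show ?thesis .
qed

text \<open>
  The cost of a flow that sends \<open>c\<close> along the edge \<open>u 1 u (n+1)\<close>. In the order
  \<open>u 1, v 1, u 2, \<dots>, u (n+1)\<close>, the number \<open>s j\<close> is the total supply of the first \<open>j + 1\<close>
  vertices, so the \<open>i\<close>-th triangle receives \<open>s (2 * i) - c\<close> at one end and passes on
  \<open>s (2 * i + 1) - c\<close> at the other. The cheapest flow in a triangle with supplies \<open>x + y + z = 0\<close>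
  costs \<open>max \<bar>x\<bar> \<bar>y\<bar> \<bar>z\<bar> = (\<bar>x\<bar> + \<bar>y\<bar> + \<bar>z\<bar>) / 2\<close>.
\<close>

definition flow_cost :: "nat \<Rightarrow> (nat \<Rightarrow> real) \<Rightarrow> real \<Rightarrow> real" where
  "flow_cost n s c = \<bar>c\<bar> +
    (\<Sum>i<n. (\<bar>c - s (2 * i)\<bar> + \<bar>c - s (2 * i + 1)\<bar> + \<bar>s (2 * i) - s (2 * i + 1)\<bar>) / 2)"

definition flow_gauge :: "nat \<Rightarrow> (nat \<Rightarrow> real) \<Rightarrow> real" where
  "flow_gauge n s = (INF c. flow_cost n s c)"

text \<open>
  At \<open>x, y \<noteq> 0\<close> this is \<open>(sgn x + sgn y) / 2\<close>; fixing the values at \<open>0\<close> keeps it an integer.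
\<close>

definition side :: "real \<Rightarrow> real \<Rightarrow> int" where
  "side x y = (if 0 \<le> x then 1 else 0) - (if y < 0 then 1 else 0)"

lemma measurable_add_int [measurable (raw)]:
  fixes f g :: "'a \<Rightarrow> int"
  assumes f: "f \<in> M \<rightarrow>\<^sub>M count_space UNIV" and g: "g \<in> M \<rightarrow>\<^sub>M count_space UNIV"
  shows "(\<lambda>x. f x + g x) \<in> M \<rightarrow>\<^sub>M count_space UNIV"
  by (rule measurable_compose_countable[OF measurable_compose[OF g] f]) simp

lemma measurable_sum_int [measurable (raw)]:
  fixes f :: "'i \<Rightarrow> 'a \<Rightarrow> int"
  shows "(\<And>i. i \<in> I \<Longrightarrow> f i \<in> M \<rightarrow>\<^sub>M count_space UNIV) \<Longrightarrow>
    (\<lambda>x. \<Sum>i\<in>I. f i x) \<in> M \<rightarrow>\<^sub>M count_space UNIV"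
  by (induction I rule: infinite_finite_induct) (simp_all add: measurable_add_int)

lemma measurable_side [measurable (raw)]:
  assumes [measurable]: "f \<in> borel_measurable M" "g \<in> borel_measurable M"
  shows "(\<lambda>x. side (f x) (g x)) \<in> M \<rightarrow>\<^sub>M count_space UNIV"
proof -
  have "side (f x) (g x) = (if 0 \<le> f x then if g x < 0 then 0 else 1 else if g x < 0 then - 1 else 0)" for x
    by (simp add: side_def)
  then show ?thesis by simp
qed

text \<open>A subgradient of \<open>flow_cost n s\<close> at \<open>c\<close>, equal to the
  derivative away from the corners \<open>0\<close> and \<open>s j\<close>. It is the end point of a
  path that starts at \<open>side c c\<close> and makes one step per triangle.\<close>

definition flow_slope :: "nat \<Rightarrow> (nat \<Rightarrow> real) \<Rightarrow> real \<Rightarrow> int" where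
  "flow_slope n s c = side c c + (\<Sum>i<n. side (c - s (2 * i)) (c - s (2 * i + 1)))"

lemma measurable_flow_cost:
  assumes s: "\<And>j. j < 2 * n \<Longrightarrow> (\<lambda>x. s x j) \<in> borel_measurable M"
    and [measurable]: "c \<in> borel_measurable M"
  shows "(\<lambda>x. flow_cost n (s x) (c x)) \<in> borel_measurable M"
  unfolding flow_cost_def
proof (intro borel_measurable_add borel_measurable_sum)
  fix i assume "i \<in> {..<n}"
  then have [measurable]: "(\<lambda>x. s x (2 * i)) \<in> borel_measurable M" "(\<lambda>x. s x (2 * i + 1)) \<in> borel_measurable M"
    using s by auto
  show "(\<lambda>x. (\<bar>c x - s x (2 * i)\<bar> + \<bar>c x - s x (2 * i + 1)\<bar> + \<bar>s x (2 * i) - s x (2 * i + 1)\<bar>) / 2)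
      \<in> borel_measurable M"
    by measurable
qed measurable

lemma measurable_flow_slope:
  assumes s: "\<And>j. j < 2 * n \<Longrightarrow> (\<lambda>x. s x j) \<in> borel_measurable M"
    and [measurable]: "c \<in> borel_measurable M"
  shows "(\<lambda>x. flow_slope n (s x) (c x)) \<in> M \<rightarrow>\<^sub>M count_space UNIV"
  unfolding flow_slope_def
  by (intro measurable_add_int measurable_sum_int measurable_side borel_measurable_diff s) auto

lemma continuous_on_flow_cost: "continuous_on A (flow_cost n s)"
  unfolding flow_cost_def by (intro continuous_intros) simp

lemma abs_le_flow_cost: "\<bar>c\<bar> \<le> flow_cost n s c"
  unfolding flow_cost_def by (simp add: sum_nonneg)

lemma flow_gauge_attained:
  obtains c where "flow_gauge n s = flow_cost n s c" "\<And>x. flow_cost n s c \<le> flow_cost n s x"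
proof -
  obtain c where c: "\<And>x. flow_cost n s c \<le> flow_cost n s x"
    using coercive_attains_min[OF continuous_on_flow_cost abs_le_flow_cost] by blast
  then have "flow_gauge n s = flow_cost n s c"
    unfolding flow_gauge_def by (intro cInf_eq_minimum) auto
  with c show thesis by (intro that)
qed

lemma flow_gauge_le_iff: "flow_gauge n s \<le> r \<longleftrightarrow> (\<exists>c. flow_cost n s c \<le> r)"
  by (metis flow_gauge_attained order_trans order_refl)

text \<open>Replaces the minimum over \<open>c\<close> by an integral over \<open>c\<close>, which
  can then be exchanged with the integral over \<open>s\<close>.\<close>

lemma exp_flow_gauge:
  "ennreal (exp (- flow_gauge n s)) =
    (\<integral>\<^sup>+c. ennreal (real_of_int (flow_slope n s c) * exp (- flow_cost n s c)) \<partial>lborel)"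
proof -
  obtain c0 where c0: "flow_gauge n s = flow_cost n s c0" "\<And>x. flow_cost n s c0 \<le> flow_cost n s x"
    using flow_gauge_attained by blast
  have abs_deriv: "((\<lambda>c. \<bar>c - t\<bar>) has_real_derivative sgn (x - t)) (at x)" if "x \<noteq> t" for x t :: real
  proof (cases "x > t")
    case True
    have "((\<lambda>c. c - t) has_real_derivative 1) (at x)"
      by (auto intro!: derivative_eq_intros)
    then have "((\<lambda>c. \<bar>c - t\<bar>) has_real_derivative 1) (at x)"
      by (rule has_field_derivative_transform_within_open[where S = "{t<..}"]) (use True in auto)
    then show ?thesis using True by simp
  next
    case False
    have "((\<lambda>c. - (c - t)) has_real_derivative - 1) (at x)"
      by (auto intro!: derivative_eq_intros)
    then have "((\<lambda>c. \<bar>c - t\<bar>) has_real_derivative - 1) (at x)"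
      by (rule has_field_derivative_transform_within_open[where S = "{..<t}"]) (use False that in auto)
    then show ?thesis using False that by simp
  qed
  have "(\<integral>\<^sup>+c. ennreal (real_of_int (flow_slope n s c) * exp (- flow_cost n s c)) \<partial>lborel) =
      ennreal (exp (- flow_cost n s c0))"
  proof (rule nn_integral_exp_minimum[where S = "insert 0 (s ` {..<2 * n})"])
    show "(\<lambda>c. real_of_int (flow_slope n s c)) \<in> borel_measurable borel"
      by (rule measurable_compose[OF measurable_flow_slope]) auto
    fix x y
    show "flow_cost n s x + real_of_int (flow_slope n s x) * (y - x) \<le> flow_cost n s y"
    proof -
      have origin: "\<bar>x\<bar> + real_of_int (side x x) * (y - x) \<le> \<bar>y\<bar>"
        by (auto simp: side_def)
      have pair: "(\<bar>x - t\<bar> + \<bar>x - u\<bar> + \<bar>t - u\<bar>) / 2 + real_of_int (side (x - t) (x - u)) * (y - x)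
          \<le> (\<bar>y - t\<bar> + \<bar>y - u\<bar> + \<bar>t - u\<bar>) / 2" for t u
      proof -
        \<comment> \<open>\<open>A t\<close> is the right-hand slope of the distance to
          \<open>t\<close> at \<open>x\<close>; \<open>side\<close> is the mean of two such slopes,
          also at the corners.\<close>
        define A :: "real \<Rightarrow> real" where "A t = (if 0 \<le> x - t then 1 else - 1)" for t
        have "\<bar>x - t\<bar> + A t * (y - x) \<le> \<bar>y - t\<bar>" for t
          by (auto simp: A_def)
        from this[of t] this[of u] have "(\<bar>x - t\<bar> + \<bar>x - u\<bar> + \<bar>t - u\<bar>) / 2 + (A t + A u) / 2 * (y - x)
            \<le> (\<bar>y - t\<bar> + \<bar>y - u\<bar> + \<bar>t - u\<bar>) / 2"
          by (simp add: field_simps)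
        moreover have "real_of_int (side (x - t) (x - u)) = (A t + A u) / 2"
          by (simp add: A_def side_def)
        ultimately show ?thesis by (simp only:)
      qed
      have "flow_cost n s x + real_of_int (flow_slope n s x) * (y - x) =
          (\<bar>x\<bar> + real_of_int (side x x) * (y - x)) +
          (\<Sum>i<n. (\<bar>x - s (2 * i)\<bar> + \<bar>x - s (2 * i + 1)\<bar> + \<bar>s (2 * i) - s (2 * i + 1)\<bar>) / 2 +
            real_of_int (side (x - s (2 * i)) (x - s (2 * i + 1))) * (y - x))"
        unfolding flow_cost_def flow_slope_def of_int_add of_int_sum distrib_right sum_distrib_right sum.distrib
        by (simp only: add_ac)
      also have "\<dots> \<le> flow_cost n s y"
        unfolding flow_cost_def by (intro add_mono sum_mono origin pair)
      finally show ?thesis .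
    qed
    show "(flow_cost n s has_real_derivative real_of_int (flow_slope n s x)) (at x)"
      if "x \<notin> insert 0 (s ` {..<2 * n})"
    proof -
      have pair: "((\<lambda>c. (\<bar>c - t\<bar> + \<bar>c - u\<bar> + r) / 2) has_real_derivative real_of_int (side (x - t) (x - u))) (at x)"
        if "x \<noteq> t" "x \<noteq> u" for t u r
      proof -
        have "((\<lambda>c. (\<bar>c - t\<bar> + \<bar>c - u\<bar> + r) / 2) has_real_derivative
            (sgn (x - t) + sgn (x - u) + 0) / 2) (at x)"
          by (intro DERIV_cdivide DERIV_add abs_deriv DERIV_const that)
        also have "(sgn (x - t) + sgn (x - u) + 0) / 2 = real_of_int (side (x - t) (x - u))"
          using that by (simp add: side_def sgn_if)
        finally show ?thesis .
      qed
      have "(abs has_real_derivative real_of_int (side x x)) (at x)"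
        using abs_deriv[of x 0] that by (cases "x > 0") (auto simp: side_def sgn_if)
      moreover have "x \<noteq> s (2 * i)" "x \<noteq> s (2 * i + 1)" if "i < n" for i
        using that \<open>x \<notin> _\<close> by auto
      ultimately show ?thesis
        unfolding flow_cost_def flow_slope_def of_int_add of_int_sum
        by (intro DERIV_add DERIV_sum pair) auto
    qed
  qed (use c0 abs_le_flow_cost continuous_on_flow_cost in auto)
  then show ?thesis by (simp add: c0)
qed

section \<open>Integrals over a single triangle\<close>

lemma nn_integral_halves:
  fixes f :: "real \<Rightarrow> ennreal"
  assumes [measurable]: "f \<in> borel_measurable borel"
  shows "(\<integral>\<^sup>+x. f x \<partial>lborel) =
    (\<integral>\<^sup>+x. f x * indicator {0<..} x \<partial>lborel) + (\<integral>\<^sup>+x. f (- x) * indicator {0<..} x \<partial>lborel)"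
proof -
  have "(\<integral>\<^sup>+x. f x * indicator {..<0} x \<partial>lborel) = (\<integral>\<^sup>+x. f (- x) * indicator {0<..} x \<partial>lborel)"
    by (subst nn_integral_real_affine[where c = "-1" and t = 0])
       (auto simp: indicator_def intro!: nn_integral_cong)
  moreover have "(\<integral>\<^sup>+x. f x \<partial>lborel) =
      (\<integral>\<^sup>+x. f x * indicator {0<..} x + f x * indicator {..<0} x \<partial>lborel)"
    by (rule nn_integral_cong_AE, rule AE_mp[OF AE_lborel_singleton[of 0]], intro AE_I2 impI)
       (auto simp: indicator_def)
  ultimately show ?thesis by (simp add: nn_integral_add)
qed

lemma nn_integral_greaterThan_eq_atLeast:
  fixes f :: "real \<Rightarrow> ennreal"
  shows "(\<integral>\<^sup>+x. f x * indicator {a<..} x \<partial>lborel) = (\<integral>\<^sup>+x. f x * indicator {a..} x \<partial>lborel)"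
  by (rule nn_integral_cong_AE, rule AE_mp[OF AE_lborel_singleton[of a]], intro AE_I2 impI)
     (auto simp: indicator_def)

text \<open>Split at \<open>z = y\<close>: the constant part contributes
  \<open>y * exp (- y)\<close> and the tail \<open>exp (- y)\<close>.\<close>

lemma nn_integral_exp_max:
  assumes "y > 0"
  shows "(\<integral>\<^sup>+z. ennreal (exp (- max y z)) * indicator {0<..} z \<partial>lborel) = ennreal ((y + 1) * exp (- y))"
proof -
  have "(\<integral>\<^sup>+z. ennreal (exp (- max y z)) * indicator {0<..} z \<partial>lborel) =
      (\<integral>\<^sup>+z. ennreal (exp (- y)) * indicator {0<..<y} z + ennreal (exp (- z)) * indicator {y..} z \<partial>lborel)"
    using assms by (intro nn_integral_cong) (auto simp: indicator_def max_def)
  also have "\<dots> = ennreal (exp (- y)) * ennreal y + ennreal (exp (- y))"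
    using assms by (subst nn_integral_add) (auto simp: nn_integral_exp_tail nn_integral_cmult)
  also have "\<dots> = ennreal ((y + 1) * exp (- y))"
    using assms by (simp add: ennreal_mult[symmetric] ennreal_plus[symmetric] algebra_simps del: ennreal_plus)
  finally show ?thesis .
qed

lemma nn_integral_add_one_exp:
  "(\<integral>\<^sup>+y. ennreal ((y + 1) * exp (- y)) * indicator {0<..} y \<partial>lborel) = 2"
proof -
  have "((\<lambda>y::real. - ((y + 2) * exp (- y))) \<longlongrightarrow> 0) at_top"
  proof -
    have "((\<lambda>y::real. - (y ^ 1 / exp y + 2 * exp (- y))) \<longlongrightarrow> - (0 + 2 * 0)) at_top"
      by (intro tendsto_intros tendsto_power_div_exp_0
          filterlim_compose[OF exp_at_bot] filterlim_uminus_at_bot_at_top)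
    then show ?thesis by (simp add: exp_minus field_simps)
  qed
  \<comment> \<open>The antiderivative \<open>- ((y + 2) * exp (- y))\<close> has value
    \<open>-2\<close> at \<open>0\<close> and limit \<open>0\<close> at infinity.\<close>
  then have "(\<integral>\<^sup>+y. ennreal ((y + 1) * exp (- y)) * indicator {0..} y \<partial>lborel) =
      ennreal (0 - (- ((0 + 2) * exp (- 0))))"
    by (intro nn_integral_FTC_atLeast[where F = "\<lambda>y. - ((y + 2) * exp (- y))"])
       (auto intro!: derivative_eq_intros simp: algebra_simps)
  then show ?thesis by (simp add: nn_integral_greaterThan_eq_atLeast)
qed

text \<open>The factor of one triangle when its two coordinates are taken relative to
  \<open>c\<close>: the exponent is minus the cost of its cheapest flow.\<close>

definition pair_weight :: "real \<Rightarrow> real \<Rightarrow> real" where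
  "pair_weight y z = exp (- ((\<bar>y\<bar> + \<bar>z\<bar> + \<bar>y - z\<bar>) / 2))"

lemma measurable_pair_weight [measurable (raw)]:
  assumes [measurable]: "f \<in> borel_measurable M" "g \<in> borel_measurable M"
  shows "(\<lambda>x. pair_weight (f x) (g x)) \<in> borel_measurable M"
  unfolding pair_weight_def by measurable

text \<open>Split the plane into quadrants. Where the signs agree, the weight is
  \<open>exp (- max \<bar>y\<bar> \<bar>z\<bar>)\<close> with mass \<open>2\<close>, and the step is
  \<open>-1\<close> or \<open>1\<close>. The two mixed quadrants have mass \<open>1\<close> each and
  step \<open>0\<close>. So every step has mass \<open>2\<close>.\<close>

lemma nn_integral_pair_weight:
  fixes \<phi> :: "int \<Rightarrow> nat"
  shows "(\<integral>\<^sup>+y. \<integral>\<^sup>+z. ennreal (pair_weight y z) * of_nat (\<phi> (m + side (- y) (- z))) \<partial>lborel \<partial>lborel) =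
    of_nat (2 * (\<phi> (m + 1) + \<phi> m + \<phi> (m - 1)))"
proof -
  have weights: "pair_weight y z = exp (- max y z)" "pair_weight y (- z) = exp (- y) * exp (- z)"
      "pair_weight (- y) z = exp (- y) * exp (- z)" "pair_weight (- y) (- z) = exp (- max y z)"
    if "y > 0" "z > 0" for y z
    using that by (auto simp: pair_weight_def max_def exp_add[symmetric] abs_if field_simps)
  define F where "F y = (\<integral>\<^sup>+z. ennreal (pair_weight y z) * of_nat (\<phi> (m + side (- y) (- z))) \<partial>lborel)" for y
  have "F \<in> borel_measurable borel"
    unfolding F_def by measurable
  have exp1: "(\<integral>\<^sup>+z. ennreal (exp (- z)) * indicator {0<..} z \<partial>lborel) = 1"
    unfolding nn_integral_greaterThan_eq_atLeast nn_integral_exp_tail by simp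
  have F: "F y = ennreal ((y + 1) * exp (- y)) * of_nat (\<phi> (m - 1)) + ennreal (exp (- y)) * of_nat (\<phi> m)"
      "F (- y) = ennreal (exp (- y)) * of_nat (\<phi> m) + ennreal ((y + 1) * exp (- y)) * of_nat (\<phi> (m + 1))"
    if "y > 0" for y
  proof -
    have c: "(\<integral>\<^sup>+z. ennreal (exp (- max y z)) * of_nat k * indicator {0<..} z \<partial>lborel) =
        ennreal ((y + 1) * exp (- y)) * of_nat k" for k
    proof -
      have "(\<integral>\<^sup>+z. ennreal (exp (- max y z)) * of_nat k * indicator {0<..} z \<partial>lborel) =
          (\<integral>\<^sup>+z. ennreal (exp (- max y z)) * indicator {0<..} z * of_nat k \<partial>lborel)"
        by (simp only: mult_ac)
      also have "\<dots> = ennreal ((y + 1) * exp (- y)) * of_nat k"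
        by (subst nn_integral_multc) (simp_all add: nn_integral_exp_max[OF that])
      finally show ?thesis .
    qed
    have d: "(\<integral>\<^sup>+z. ennreal (exp (- y) * exp (- z)) * of_nat k * indicator {0<..} z \<partial>lborel) =
        ennreal (exp (- y)) * of_nat k" for k
      using nn_integral_multc[of "\<lambda>z. ennreal (exp (- z)) * indicator {0<..} z" lborel "ennreal (exp (- y)) * of_nat k"]
      by (simp add: exp1 ennreal_mult mult_ac)
    show "F y = ennreal ((y + 1) * exp (- y)) * of_nat (\<phi> (m - 1)) + ennreal (exp (- y)) * of_nat (\<phi> m)"
      unfolding F_def
    proof (subst nn_integral_halves, goal_cases)
      case 2
      show ?case
        unfolding c[symmetric] d[symmetric]
        using that by (intro arg_cong2[where f = "(+)"] nn_integral_cong)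
          (auto simp: indicator_def side_def weights)
    qed measurable
    show "F (- y) = ennreal (exp (- y)) * of_nat (\<phi> m) + ennreal ((y + 1) * exp (- y)) * of_nat (\<phi> (m + 1))"
      unfolding F_def
    proof (subst nn_integral_halves, goal_cases)
      case 2
      show ?case
        unfolding c[symmetric] d[symmetric]
        using that by (intro arg_cong2[where f = "(+)"] nn_integral_cong)
          (auto simp: indicator_def side_def weights)
    qed measurable
  qed
  have "(\<integral>\<^sup>+y. F y \<partial>lborel) =
      (\<integral>\<^sup>+y. F y * indicator {0<..} y \<partial>lborel) + (\<integral>\<^sup>+y. F (- y) * indicator {0<..} y \<partial>lborel)"
    by (rule nn_integral_halves) fact
  also have "(\<integral>\<^sup>+y. F y * indicator {0<..} y \<partial>lborel) =
      (\<integral>\<^sup>+y. ennreal ((y + 1) * exp (- y)) * indicator {0<..} y * of_nat (\<phi> (m - 1)) +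
        ennreal (exp (- y)) * indicator {0<..} y * of_nat (\<phi> m) \<partial>lborel)"
    by (intro nn_integral_cong) (auto simp: F indicator_def)
  also have "\<dots> = 2 * of_nat (\<phi> (m - 1)) + of_nat (\<phi> m)"
    by (simp add: nn_integral_add nn_integral_multc nn_integral_add_one_exp exp1)
  also have "(\<integral>\<^sup>+y. F (- y) * indicator {0<..} y \<partial>lborel) =
      (\<integral>\<^sup>+y. ennreal ((y + 1) * exp (- y)) * indicator {0<..} y * of_nat (\<phi> (m + 1)) +
        ennreal (exp (- y)) * indicator {0<..} y * of_nat (\<phi> m) \<partial>lborel)"
    by (intro nn_integral_cong) (auto simp: F indicator_def)
  also have "\<dots> = 2 * of_nat (\<phi> (m + 1)) + of_nat (\<phi> m)"
    by (simp add: nn_integral_add nn_integral_multc nn_integral_add_one_exp exp1)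
  finally show ?thesis
    unfolding F_def by (simp only: of_nat_mult of_nat_add of_nat_numeral distrib_left mult_2 add_ac)
qed

section \<open>Integration over all triangles\<close>

lemma measurable_coordinate: "j < m \<Longrightarrow> (\<lambda>s. s j) \<in> borel_measurable (PiM {..<m::nat} (\<lambda>_. lborel))"
  using measurable_component_singleton[of j "{..<m}" "\<lambda>_. lborel"] by simp

lemma measurable_prod_pair_weight:
  fixes \<phi> :: "int \<Rightarrow> nat" and n :: nat
  shows "(\<lambda>s. (\<Prod>i<n. ennreal (pair_weight (s (2 * i)) (s (2 * i + 1)))) *
      of_nat (\<phi> (\<Sum>i<n. side (- s (2 * i)) (- s (2 * i + 1)))))
    \<in> borel_measurable (PiM {..<2 * n} (\<lambda>_. lborel))"
proof -
  note [measurable] = measurable_coordinate[of _ "2 * n"]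
  show ?thesis
    by (intro borel_measurable_times_ennreal borel_measurable_prod_ennreal) measurable
qed

lemma measurable_flow_slope_exp_cost:
  "(\<lambda>x. ennreal (real_of_int (flow_slope n (fst x) (snd x)) * exp (- flow_cost n (fst x) (snd x))))
    \<in> borel_measurable (PiM {..<2 * n} (\<lambda>_. lborel) \<Otimes>\<^sub>M borel)"
proof -
  let ?N = "PiM {..<2 * n} (\<lambda>_. lborel) \<Otimes>\<^sub>M (borel :: real measure)"
  have coordinate: "(\<lambda>x. fst x j) \<in> borel_measurable ?N" if "j < 2 * n" for j
    by (rule measurable_compose[OF measurable_fst measurable_coordinate[OF that]])
  have [measurable]: "(\<lambda>x. flow_cost n (fst x) (snd x)) \<in> borel_measurable ?N"
    by (rule measurable_flow_cost[OF coordinate measurable_snd])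
  have "(\<lambda>x. flow_slope n (fst x) (snd x)) \<in> ?N \<rightarrow>\<^sub>M count_space UNIV"
    by (rule measurable_flow_slope[OF coordinate measurable_snd])
  then have [measurable]: "(\<lambda>x. real_of_int (flow_slope n (fst x) (snd x))) \<in> borel_measurable ?N"
    by (rule measurable_compose) simp
  show ?thesis by measurable
qed

text \<open>Integrating out the last triangle yields a factor \<open>2\<close> and replaces
  \<open>\<phi>\<close> by its sum over three steps, which is the recursion of
  \<open>spread\<close>.\<close>

lemma nn_integral_prod_pair_weight:
  fixes \<phi> :: "int \<Rightarrow> nat"
  shows "(\<integral>\<^sup>+s. (\<Prod>i<n. ennreal (pair_weight (s (2 * i)) (s (2 * i + 1)))) *
      of_nat (\<phi> (\<Sum>i<n. side (- s (2 * i)) (- s (2 * i + 1)))) \<partial>PiM {..<2 * n} (\<lambda>_. lborel)) =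
    of_nat (2 ^ n * spread n \<phi>)"
proof (induction n arbitrary: \<phi>)
  case 0
  then show ?case by (simp add: PiM_empty nn_integral_count_space_finite)
next
  case (Suc n)
  define F where "F m \<phi> s = (\<Prod>i<m. ennreal (pair_weight (s (2 * i)) (s (2 * i + 1)))) *
      of_nat (\<phi> (\<Sum>i<m. side (- s (2 * i)) (- s (2 * i + 1))))"
    for m and \<phi> :: "int \<Rightarrow> nat" and s :: "nat \<Rightarrow> real"
  have F_measurable: "F m \<phi> \<in> borel_measurable (PiM {..<2 * m} (\<lambda>_. lborel))" for m \<phi>
    unfolding F_def by (rule measurable_prod_pair_weight)
  have eq: "{..<2 * Suc n} = insert (2 * n + 1) (insert (2 * n) {..<2 * n})"
    by auto
  have ins2: "2 * n + 1 \<notin> insert (2 * n) {..<2 * n}" "finite (insert (2 * n) {..<2 * n})"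
    by auto
  have "(\<integral>\<^sup>+s. F (Suc n) \<phi> s \<partial>PiM {..<2 * Suc n} (\<lambda>_. lborel)) =
      (\<integral>\<^sup>+s. \<integral>\<^sup>+z. F (Suc n) \<phi> (s(2 * n + 1 := z)) \<partial>lborel \<partial>PiM (insert (2 * n) {..<2 * n}) (\<lambda>_. lborel))"
    unfolding eq
    by (rule lborel_PiM.product_nn_integral_insert[OF ins2(2,1)]) (use F_measurable[of "Suc n"] in \<open>simp only: eq\<close>)
  also have "\<dots> = (\<integral>\<^sup>+s. \<integral>\<^sup>+y. \<integral>\<^sup>+z. F (Suc n) \<phi> (s(2 * n := y, 2 * n + 1 := z)) \<partial>lborel \<partial>lborel \<partial>PiM {..<2 * n} (\<lambda>_. lborel))"
  proof (rule lborel_PiM.product_nn_integral_insert)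
    note [measurable] = F_measurable[of "Suc n" \<phi>, unfolded eq]
    show "(\<lambda>s. \<integral>\<^sup>+z. F (Suc n) \<phi> (s(2 * n + 1 := z)) \<partial>lborel)
        \<in> borel_measurable (PiM (insert (2 * n) {..<2 * n}) (\<lambda>_. lborel))"
      by measurable
  qed auto
  also have "\<dots> = (\<integral>\<^sup>+s. 2 * F n (\<lambda>m. \<phi> (m + 1) + \<phi> m + \<phi> (m - 1)) s \<partial>PiM {..<2 * n} (\<lambda>_. lborel))"
  proof (rule nn_integral_cong)
    fix s
    let ?W = "\<Prod>i<n. ennreal (pair_weight (s (2 * i)) (s (2 * i + 1)))"
    let ?m = "\<Sum>i<n. side (- s (2 * i)) (- s (2 * i + 1))"
    have [measurable]: "(\<lambda>x. ennreal (pair_weight (fst x) (snd x)) * of_nat (\<phi> (?m + side (- fst x) (- snd x))))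
      \<in> borel_measurable (borel \<Otimes>\<^sub>M borel)"
      by measurable
    have "F (Suc n) \<phi> (s(2 * n := y, 2 * n + 1 := z)) =
        ?W * (ennreal (pair_weight y z) * of_nat (\<phi> (?m + side (- y) (- z))))" for y z
    proof -
      have "(\<Prod>i<n. ennreal (pair_weight ((s(2 * n := y, 2 * n + 1 := z)) (2 * i)) ((s(2 * n := y, 2 * n + 1 := z)) (2 * i + 1)))) = ?W"
        by (rule prod.cong) auto
      moreover have "(\<Sum>i<n. side (- (s(2 * n := y, 2 * n + 1 := z)) (2 * i)) (- (s(2 * n := y, 2 * n + 1 := z)) (2 * i + 1))) = ?m"
        by (rule sum.cong) auto
      ultimately show ?thesis
        unfolding F_def prod.lessThan_Suc sum.lessThan_Suc by (simp add: mult_ac)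
    qed
    then have "(\<integral>\<^sup>+y. \<integral>\<^sup>+z. F (Suc n) \<phi> (s(2 * n := y, 2 * n + 1 := z)) \<partial>lborel \<partial>lborel) =
        (\<integral>\<^sup>+y. ?W * (\<integral>\<^sup>+z. ennreal (pair_weight y z) * of_nat (\<phi> (?m + side (- y) (- z))) \<partial>lborel) \<partial>lborel)"
      by (simp only:, intro nn_integral_cong nn_integral_cmult) measurable
    also have "\<dots> = ?W * (\<integral>\<^sup>+y. \<integral>\<^sup>+z. ennreal (pair_weight y z) * of_nat (\<phi> (?m + side (- y) (- z))) \<partial>lborel \<partial>lborel)"
      by (rule nn_integral_cmult) measurable
    finally show "(\<integral>\<^sup>+y. \<integral>\<^sup>+z. F (Suc n) \<phi> (s(2 * n := y, 2 * n + 1 := z)) \<partial>lborel \<partial>lborel) =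
        2 * F n (\<lambda>m. \<phi> (m + 1) + \<phi> m + \<phi> (m - 1)) s"
      unfolding nn_integral_pair_weight F_def by (simp only: of_nat_mult of_nat_numeral mult_ac)
  qed
  also have "\<dots> = 2 * (\<integral>\<^sup>+s. F n (\<lambda>m. \<phi> (m + 1) + \<phi> m + \<phi> (m - 1)) s \<partial>PiM {..<2 * n} (\<lambda>_. lborel))"
    by (rule nn_integral_cmult) (rule F_measurable)
  also have "(\<integral>\<^sup>+s. F n (\<lambda>m. \<phi> (m + 1) + \<phi> m + \<phi> (m - 1)) s \<partial>PiM {..<2 * n} (\<lambda>_. lborel)) =
      of_nat (2 ^ n * spread n (\<lambda>m. \<phi> (m + 1) + \<phi> m + \<phi> (m - 1)))"
    unfolding F_def by (rule Suc.IH)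
  also have "2 * \<dots> = of_nat (2 ^ Suc n * spread (Suc n) \<phi>)"
    by (simp add: mult.assoc)
  finally show ?case unfolding F_def .
qed

lemma nn_integral_exp_flow_gauge:
  "(\<integral>\<^sup>+s. ennreal (exp (- flow_gauge n s)) \<partial>PiM {..<2 * n} (\<lambda>_. lborel)) =
    of_nat (2 ^ n * spread n (\<lambda>m. nat (m + 1) + nat (m - 1)))"
proof -
  define M where "M = PiM {..<2 * n} (\<lambda>_. lborel :: real measure)"
  interpret sigma_finite_measure M unfolding M_def by (rule lborel_PiM.sigma_finite) simp
  interpret pair_sigma_finite M "lborel :: real measure" ..
  define H where "H s c = ennreal (real_of_int (flow_slope n s c) * exp (- flow_cost n s c))" for s c
  have H[measurable]: "(\<lambda>x. H (fst x) (snd x)) \<in> borel_measurable (M \<Otimes>\<^sub>M borel)"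
    unfolding H_def M_def by (rule measurable_flow_slope_exp_cost)
  have H_section: "(\<lambda>s. H s c) \<in> borel_measurable M" for c
  proof -
    have "(\<lambda>s. (s, c)) \<in> M \<rightarrow>\<^sub>M M \<Otimes>\<^sub>M borel" by measurable
    from measurable_compose[OF this H] show ?thesis by simp
  qed
  \<comment> \<open>Substituting \<open>s i + c\<close> for \<open>s i\<close> turns
    \<open>c - s i\<close> into \<open>- s i\<close>. Afterwards \<open>c\<close> enters only
    through \<open>\<bar>c\<bar>\<close> and \<open>side c c\<close>.\<close>
  have shift: "(\<integral>\<^sup>+s. H s c \<partial>M) = ennreal (exp (- \<bar>c\<bar>)) * of_nat (2 ^ n * spread n (\<lambda>m. nat (side c c + m)))" for c
  proof -
    have "(\<integral>\<^sup>+s. H s c \<partial>M) = (\<integral>\<^sup>+s. H (\<lambda>i\<in>{..<2 * n}. s i + c) c \<partial>M)"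
      using H_section unfolding M_def by (intro nn_integral_PiM_lborel_translate[symmetric]) auto
    also have "\<dots> = (\<integral>\<^sup>+s. ennreal (exp (- \<bar>c\<bar>)) *
        ((\<Prod>i<n. ennreal (pair_weight (s (2 * i)) (s (2 * i + 1)))) *
         of_nat (nat (side c c + (\<Sum>i<n. side (- s (2 * i)) (- s (2 * i + 1)))))) \<partial>M)"
    proof (rule nn_integral_cong)
      fix s :: "nat \<Rightarrow> real"
      let ?s = "\<lambda>i\<in>{..<2 * n}. s i + c" and ?m = "side c c + (\<Sum>i<n. side (- s (2 * i)) (- s (2 * i + 1)))"
      have slope: "flow_slope n ?s c = ?m"
        unfolding flow_slope_def by simp
      have "flow_cost n ?s c = \<bar>c\<bar> + (\<Sum>i<n. (\<bar>s (2 * i)\<bar> + \<bar>s (2 * i + 1)\<bar> + \<bar>s (2 * i) - s (2 * i + 1)\<bar>) / 2)"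
        unfolding flow_cost_def by simp
      then have "exp (- flow_cost n ?s c) = exp (- \<bar>c\<bar>) * (\<Prod>i<n. pair_weight (s (2 * i)) (s (2 * i + 1)))"
        by (simp only: minus_add_distrib exp_add sum_negf[symmetric] exp_sum finite_lessThan pair_weight_def)
      then have "H ?s c = ennreal (real_of_int ?m * (exp (- \<bar>c\<bar>) * (\<Prod>i<n. pair_weight (s (2 * i)) (s (2 * i + 1)))))"
        unfolding H_def slope by simp
      \<comment> \<open>A negative slope is truncated to \<open>0\<close> by \<open>ennreal\<close>
        on the left and by \<open>nat\<close> on the right.\<close>
      also have "\<dots> = ennreal (real (nat ?m)) * (ennreal (exp (- \<bar>c\<bar>)) * ennreal (\<Prod>i<n. pair_weight (s (2 * i)) (s (2 * i + 1))))"
      proof (cases "0 \<le> ?m")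
        case True
        have "0 \<le> (\<Prod>i<n. pair_weight (s (2 * i)) (s (2 * i + 1)))"
          by (intro prod_nonneg) (simp add: pair_weight_def)
        then have "ennreal (real (nat ?m) * (exp (- \<bar>c\<bar>) * (\<Prod>i<n. pair_weight (s (2 * i)) (s (2 * i + 1))))) =
          ennreal (real (nat ?m)) * (ennreal (exp (- \<bar>c\<bar>)) * ennreal (\<Prod>i<n. pair_weight (s (2 * i)) (s (2 * i + 1))))"
          by (simp only: ennreal_mult of_nat_0_le_iff exp_ge_zero mult_nonneg_nonneg)
        then show ?thesis using True by (simp only: of_nat_nat)
      next
        case False
        then have "real_of_int ?m \<le> 0" by (simp only: of_int_le_0_iff)
        then have "real_of_int ?m * (exp (- \<bar>c\<bar>) * (\<Prod>i<n. pair_weight (s (2 * i)) (s (2 * i + 1)))) \<le> 0"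
          by (intro mult_nonpos_nonneg mult_nonneg_nonneg prod_nonneg) (auto simp: pair_weight_def)
        then show ?thesis using False by (simp add: ennreal_neg)
      qed
      also have "ennreal (\<Prod>i<n. pair_weight (s (2 * i)) (s (2 * i + 1))) =
          (\<Prod>i<n. ennreal (pair_weight (s (2 * i)) (s (2 * i + 1))))"
        by (rule prod_ennreal[symmetric]) (simp add: pair_weight_def)
      finally show "H ?s c = ennreal (exp (- \<bar>c\<bar>)) *
        ((\<Prod>i<n. ennreal (pair_weight (s (2 * i)) (s (2 * i + 1)))) * of_nat (nat ?m))"
        by (simp only: ennreal_of_nat_eq_real_of_nat mult_ac)
    qed
    also have "\<dots> = ennreal (exp (- \<bar>c\<bar>)) * (\<integral>\<^sup>+s.
        (\<Prod>i<n. ennreal (pair_weight (s (2 * i)) (s (2 * i + 1)))) *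
         of_nat (nat (side c c + (\<Sum>i<n. side (- s (2 * i)) (- s (2 * i + 1))))) \<partial>M)"
      unfolding M_def
      by (rule nn_integral_cmult) (rule measurable_prod_pair_weight[where \<phi> = "\<lambda>m. nat (side c c + m)"])
    finally show ?thesis
      unfolding M_def nn_integral_prod_pair_weight[where \<phi> = "\<lambda>m. nat (side c c + m)"] .
  qed
  have scaled_tail: "(\<integral>\<^sup>+c. ennreal (exp (- c)) * k * indicator {0..} c \<partial>lborel) = k" for k
  proof -
    have "(\<integral>\<^sup>+c. ennreal (exp (- c)) * k * indicator {0..} c \<partial>lborel) =
        (\<integral>\<^sup>+c. ennreal (exp (- c)) * indicator {0..} c * k \<partial>lborel)"
      by (simp only: mult_ac)
    also have "\<dots> = k"
      by (subst nn_integral_multc) (simp_all add: nn_integral_exp_tail)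
    finally show ?thesis .
  qed
  have spread_add: "spread n (\<lambda>m. \<phi> m + \<psi> m) = spread n \<phi> + spread n \<psi>" for \<phi> \<psi>
    by (simp add: spread_eq_sum sum.distrib distrib_left)
  have "(\<integral>\<^sup>+s. ennreal (exp (- flow_gauge n s)) \<partial>M) = (\<integral>\<^sup>+s. \<integral>\<^sup>+c. H s c \<partial>lborel \<partial>M)"
    unfolding H_def exp_flow_gauge ..
  also have "\<dots> = (\<integral>\<^sup>+c. \<integral>\<^sup>+s. H s c \<partial>M \<partial>lborel)"
    by (rule Fubini'[symmetric]) measurable
  \<comment> \<open>\<open>side c c\<close> is \<open>1\<close> for \<open>c > 0\<close> and
    \<open>-1\<close> for \<open>c < 0\<close>; the negative half-line is reflected.\<close>
  also have "\<dots> = (\<integral>\<^sup>+c. ennreal (exp (- c)) * of_nat (2 ^ n * spread n (\<lambda>m. nat (1 + m))) * indicator {0..} c \<partial>lborel) +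
      (\<integral>\<^sup>+c. ennreal (exp (- c)) * of_nat (2 ^ n * spread n (\<lambda>m. nat (- 1 + m))) * indicator {0..} c \<partial>lborel)"
    unfolding shift nn_integral_greaterThan_eq_atLeast[symmetric]
    by (subst nn_integral_halves)
       (auto simp: side_def indicator_def intro!: arg_cong2[where f = "(+)"] nn_integral_cong)
  also have "\<dots> = of_nat (2 ^ n * spread n (\<lambda>m. nat (1 + m))) + of_nat (2 ^ n * spread n (\<lambda>m. nat (- 1 + m)))"
    unfolding scaled_tail ..
  also have "\<dots> = of_nat (2 ^ n * spread n (\<lambda>m. nat (1 + m) + nat (- 1 + m)))"
    by (simp only: spread_add distrib_left of_nat_add)
  also have "(\<lambda>m. nat (1 + m) + nat (- 1 + m)) = (\<lambda>m. nat (m + 1) + nat (m - 1))"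
    by (simp add: add.commute)
  finally show ?thesis unfolding M_def .
qed

section \<open>Convexity, scaling and measurability of the flow gauge\<close>

lemma sum_pairs: "(\<Sum>j<2 * n. f j) = (\<Sum>i<n. f (2 * i) + f (2 * i + 1))"
  for f :: "nat \<Rightarrow> 'a::comm_monoid_add"
  by (induction n) (simp_all add: add.assoc)

text \<open>Memberships in dilates of \<open>P\<close> add up like costs, so a flow can be assembled
  edge by edge.\<close>

lemma scaled_convex_add:
  fixes P :: "'a::real_vector set"
  assumes P: "convex P" and r: "0 \<le> r" "0 \<le> q" and x: "x \<in> (*\<^sub>R) r ` P" and y: "y \<in> (*\<^sub>R) q ` P"
  shows "x + y \<in> (*\<^sub>R) (r + q) ` P"
proof (cases "r + q = 0")
  case True
  then have "r = 0" "q = 0" using r by linarith+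
  then show ?thesis using x y by auto
next
  case False
  obtain a b where ab: "x = r *\<^sub>R a" "a \<in> P" "y = q *\<^sub>R b" "b \<in> P" using x y by auto
  have "(r / (r + q)) *\<^sub>R a + (q / (r + q)) *\<^sub>R b \<in> P"
    using False r ab by (intro convexD[OF P]) (auto simp: add_divide_distrib[symmetric])
  moreover have "x + y = (r + q) *\<^sub>R ((r / (r + q)) *\<^sub>R a + (q / (r + q)) *\<^sub>R b)"
    using False by (simp add: ab scaleR_add_right)
  ultimately show ?thesis by blast
qed

lemma scaled_convex_sum:
  fixes P :: "'a::real_vector set"
  assumes P: "convex P" "P \<noteq> {}" and "finite I"
    and "\<And>i. i \<in> I \<Longrightarrow> 0 \<le> r i" "\<And>i. i \<in> I \<Longrightarrow> x i \<in> (*\<^sub>R) (r i) ` P"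
  shows "(\<Sum>i\<in>I. x i) \<in> (*\<^sub>R) (\<Sum>i\<in>I. r i) ` P"
  using assms(3-5)
proof (induction I)
  case empty
  then show ?case using P by auto
next
  case (insert i I)
  then show ?case
    by (simp add: scaled_convex_add[OF P(1)] sum_nonneg)
qed

lemma flow_cost_uminus: "flow_cost n (\<lambda>j. - s j) (- c) = flow_cost n s c"
proof -
  have "\<bar>- a - - b\<bar> = \<bar>a - b\<bar>" for a b :: real by linarith
  then show ?thesis unfolding flow_cost_def by simp
qed

lemma flow_cost_cong: "(\<And>j. j < 2 * n \<Longrightarrow> s j = t j) \<Longrightarrow> flow_cost n s c = flow_cost n t c"
  unfolding flow_cost_def by (intro arg_cong2[where f = "(+)"] sum.cong) auto

text \<open>Convexity is joint in \<open>s\<close> and \<open>c\<close>, so it survives the choice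
  of the best \<open>c\<close>: the points of gauge at most \<open>1\<close> form a convex
  set.\<close>

lemma flow_cost_convex:
  assumes "0 \<le> a" "0 \<le> b"
  shows "flow_cost n (\<lambda>j. a * s j + b * t j) (a * c + b * d) \<le> a * flow_cost n s c + b * flow_cost n t d"
proof -
  have abs: "\<bar>a * x + b * y\<bar> \<le> a * \<bar>x\<bar> + b * \<bar>y\<bar>" for x y
    using abs_triangle_ineq[of "a * x" "b * y"] assms by (simp add: abs_mult)
  have diff: "a * c + b * d - (a * x + b * x') = a * (c - x) + b * (d - x')" for c d x x'
    by (simp add: algebra_simps)
  have distrib_half: "r * ((x + y + z) / 2) = (r * x + r * y + r * z) / 2" for r x y z :: real
    by (simp add: algebra_simps)
  have "(\<bar>a * c + b * d - (a * x + b * x')\<bar> + \<bar>a * c + b * d - (a * y + b * y')\<bar> + \<bar>a * x + b * x' - (a * y + b * y')\<bar>) / 2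
      \<le> a * ((\<bar>c - x\<bar> + \<bar>c - y\<bar> + \<bar>x - y\<bar>) / 2) + b * ((\<bar>d - x'\<bar> + \<bar>d - y'\<bar> + \<bar>x' - y'\<bar>) / 2)" for x x' y y'
    using abs[of "c - x" "d - x'"] abs[of "c - y" "d - y'"] abs[of "x - y" "x' - y'"]
    unfolding diff by (simp only: distrib_half) argo
  note pair = this
  have "flow_cost n (\<lambda>j. a * s j + b * t j) (a * c + b * d) \<le> (a * \<bar>c\<bar> + b * \<bar>d\<bar>) +
      (\<Sum>i<n. a * ((\<bar>c - s (2 * i)\<bar> + \<bar>c - s (2 * i + 1)\<bar> + \<bar>s (2 * i) - s (2 * i + 1)\<bar>) / 2) +
        b * ((\<bar>d - t (2 * i)\<bar> + \<bar>d - t (2 * i + 1)\<bar> + \<bar>t (2 * i) - t (2 * i + 1)\<bar>) / 2))"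
    unfolding flow_cost_def by (intro add_mono sum_mono abs pair)
  also have "\<dots> = a * flow_cost n s c + b * flow_cost n t d"
    unfolding flow_cost_def distrib_left sum_distrib_left sum.distrib by (simp only: add_ac)
  finally show ?thesis .
qed

lemma flow_cost_scale:
  assumes "0 < r"
  shows "flow_cost n (\<lambda>j. r * s j) (r * c) = r * flow_cost n s c"
proof -
  have "\<bar>r * x - r * y\<bar> = r * \<bar>x - y\<bar>" for x y
    using assms by (simp add: right_diff_distrib[symmetric] abs_mult)
  then show ?thesis
    using assms unfolding flow_cost_def
    by (simp add: abs_mult distrib_left sum_distrib_left)
qed

lemma flow_gauge_scale:
  assumes "0 < r"
  shows "flow_gauge n (\<lambda>j\<in>{..<2 * n}. r * s j) = r * flow_gauge n s"
proof (rule antisym)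
  have cong: "flow_cost n (\<lambda>j\<in>{..<2 * n}. r * s j) c = flow_cost n (\<lambda>j. r * s j) c" for c
    by (rule flow_cost_cong) simp
  obtain c where "flow_gauge n s = flow_cost n s c" using flow_gauge_attained by blast
  then show "flow_gauge n (\<lambda>j\<in>{..<2 * n}. r * s j) \<le> r * flow_gauge n s"
    unfolding flow_gauge_le_iff cong using flow_cost_scale[OF assms] by (metis order_refl)
  obtain d where d: "flow_gauge n (\<lambda>j\<in>{..<2 * n}. r * s j) = flow_cost n (\<lambda>j. r * s j) d"
    using flow_gauge_attained cong by metis
  have "flow_gauge n s \<le> flow_cost n s (d / r)"
    using flow_gauge_le_iff by blast
  then have "r * flow_gauge n s \<le> flow_cost n (\<lambda>j. r * s j) (r * (d / r))"
    unfolding flow_cost_scale[OF assms] using assms by simp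
  then show "r * flow_gauge n s \<le> flow_gauge n (\<lambda>j\<in>{..<2 * n}. r * s j)"
    using d assms by simp
qed

lemma flow_gauge_nonneg: "0 \<le> flow_gauge n s"
  using flow_gauge_attained[of n s] abs_le_flow_cost by (metis abs_ge_zero order_trans)

text \<open>The infimum runs over uncountably many \<open>c\<close>; measurability comes instead
  from \<open>exp (- flow_gauge n s)\<close> being an integral with parameter
  \<open>s\<close>.\<close>

lemma borel_measurable_flow_gauge:
  "flow_gauge n \<in> borel_measurable (PiM {..<2 * n} (\<lambda>_. lborel))"
proof -
  define M where "M = PiM {..<2 * n} (\<lambda>_. lborel :: real measure)"
  note [measurable] = measurable_flow_slope_exp_cost[of n, folded M_def]
  have "(\<lambda>s. \<integral>\<^sup>+c. ennreal (real_of_int (flow_slope n s c) * exp (- flow_cost n s c)) \<partial>lborel)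
      \<in> borel_measurable M"
    by measurable
  then have [measurable]: "(\<lambda>s. ennreal (exp (- flow_gauge n s))) \<in> borel_measurable M"
    by (simp only: exp_flow_gauge)
  have "flow_gauge n = (\<lambda>s. - ln (enn2real (ennreal (exp (- flow_gauge n s)))))"
    by simp
  also have "\<dots> \<in> borel_measurable M"
    by measurable
  finally show ?thesis unfolding M_def .
qed

lemma flow_gauge_volume:
  "fact (2 * n) * measure (PiM {..<2 * n} (\<lambda>_. lborel))
      {s \<in> space (PiM {..<2 * n} (\<lambda>_. lborel)). flow_gauge n s \<le> 1} =
    real (2 ^ n * spread n (\<lambda>m. nat (m + 1) + nat (m - 1)))"
proof -
  have "ennreal (fact (2 * n)) * emeasure (PiM {..<2 * n} (\<lambda>_. lborel))
      {s \<in> space (PiM {..<2 * n} (\<lambda>_. lborel)). flow_gauge n s \<le> 1} =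
    of_nat (2 ^ n * spread n (\<lambda>m. nat (m + 1) + nat (m - 1)))"
    using nn_integral_exp_gauge[OF finite_lessThan borel_measurable_flow_gauge flow_gauge_nonneg flow_gauge_scale]
    by (simp only: nn_integral_exp_flow_gauge card_lessThan)
  from arg_cong[OF this, of enn2real] show ?thesis
    by (simp add: enn2real_mult measure_def ennreal_of_nat_eq_real_of_nat del: of_nat_mult of_nat_power)
qed

section \<open>The polytope as a unit ball of the flow gauge\<close>

lemma less_two_mult_iff: "j < 2 * n \<longleftrightarrow> (\<exists>i<n. j = 2 * i \<or> j = 2 * i + (1::nat))"
proof
  assume "j < 2 * n"
  then show "\<exists>i<n. j = 2 * i \<or> j = 2 * i + 1" by (intro exI[of _ "j div 2"]) auto
qed auto

locale gamma_graph =
  fixes n :: nat and u v :: "nat \<Rightarrow> 'v::finite"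
  assumes n: "n \<ge> 1"
    and inj_u: "inj_on u {1..n + 1}" and inj_v: "inj_on v {1..n}"
    and disjoint: "u ` {1..n + 1} \<inter> v ` {1..n} = {}"
    and cover: "u ` {1..n + 1} \<union> v ` {1..n} = (UNIV :: 'v set)"
begin

text \<open>The order \<open>u 1, v 1, u 2, ..., u (n+1)\<close>: triangles occupy the indices
  \<open>2 * i\<close>, \<open>2 * i + 1\<close>, \<open>2 * i + 2\<close>, and the closing edge
  joins the indices \<open>0\<close> and \<open>2 * n\<close>.\<close>

definition w :: "nat \<Rightarrow> 'v" where
  "w j = (if even j then u (j div 2 + 1) else v (j div 2 + 1))"

text \<open>Consecutive vertices under \<open>w\<close> are adjacent, so these are edge vectors of a
  Hamiltonian path. They will be the lattice basis.\<close>

definition b :: "nat \<Rightarrow> real^'v" where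
  "b j = axis (w j) 1 - axis (w (j + 1)) 1"

text \<open>On the hyperplane spanned by the \<open>b j\<close>, these partial sums are the coordinate functions.\<close>

definition prefix :: "real^'v \<Rightarrow> nat \<Rightarrow> real" where
  "prefix x j = (\<Sum>k\<le>j. x $ w k)"

abbreviation T :: "(nat \<Rightarrow> real) \<Rightarrow> real^'v" where
  "T s \<equiv> \<Sum>j<2 * n. s j *\<^sub>R b j"

abbreviation P :: "(real^'v) set" where
  "P \<equiv> symmetric_edge_polytope (Gamma_edges n u v)"

section \<open>The path basis and its dual coordinates\<close>

lemma inj_w: "inj_on w {..2 * n}"
proof (rule inj_onI)
  fix j k assume jk: "j \<in> {..2 * n}" "k \<in> {..2 * n}" "w j = w k"
  have range_u: "j div 2 + 1 \<in> {1..n + 1}" if "j \<le> 2 * n" for j using that by auto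
  have range_v: "j div 2 + 1 \<in> {1..n}" if "j \<le> 2 * n" "odd j" for j using that by (auto elim!: oddE)
  have uv: "u i \<noteq> v k" if "i \<in> {1..n + 1}" "k \<in> {1..n}" for i k
    using that disjoint by blast
  have *: "even j = even k"
    using jk uv[OF range_u[of j] range_v[of k]] uv[OF range_u[of k] range_v[of j]]
    by (auto simp: w_def split: if_splits)
  have "j div 2 + 1 = k div 2 + 1"
  proof (cases "even j")
    case True
    then show ?thesis using * jk range_u unfolding w_def by (intro inj_onD[OF inj_u]) auto
  next
    case False
    then show ?thesis using * jk range_v unfolding w_def by (intro inj_onD[OF inj_v]) auto
  qed
  with * show "j = k" by presburger
qed

text \<open>A unit vector at \<open>w m\<close> enters the partial sums from index \<open>m\<close>
  on, so the difference of two consecutive ones is visible at one index only: \<open>prefix\<close>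
  is dual to \<open>b\<close>.\<close>

lemma prefix_b:
  assumes "j < 2 * n" "k < 2 * n"
  shows "prefix (b j) k = (if j = k then 1 else 0)"
proof -
  have "prefix (axis (w m) 1) k = (if m \<le> k then 1 else 0)" if "m \<le> 2 * n" for m
  proof -
    have "prefix (axis (w m) 1) k = (\<Sum>l\<le>k. if l = m then 1 else 0)"
      unfolding prefix_def axis_def
      using that assms by (intro sum.cong) (auto dest: inj_onD[OF inj_w])
    then show ?thesis by simp
  qed
  from this[of j] this[of "j + 1"] show ?thesis
    using assms by (auto simp: b_def prefix_def sum_subtractf)
qed

lemma prefix_add: "prefix (x + y) j = prefix x j + prefix y j"
  by (simp add: prefix_def sum.distrib)

lemma prefix_scaleR: "prefix (r *\<^sub>R x) j = r * prefix x j"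
  by (simp add: prefix_def sum_distrib_left)

lemma prefix_uminus: "prefix (- x) j = - prefix x j"
  by (simp add: prefix_def sum_negf)

lemma prefix_sum: "prefix (\<Sum>i\<in>I. f i) j = (\<Sum>i\<in>I. prefix (f i) j)"
  unfolding prefix_def sum_component by (rule sum.swap)

lemma prefix_T: "j < 2 * n \<Longrightarrow> prefix (T s) j = s j"
  by (simp add: prefix_sum prefix_scaleR prefix_b if_distrib[of "(*) _"] cong: if_cong)

lemma T_prefix:
  assumes "x \<in> span (b ` {..<2 * n})"
  shows "T (prefix x) = x"
proof (rule linear_eq_on_span[OF _ linear_id, unfolded id_def, OF _ _ assms])
  show "linear (\<lambda>x. T (prefix x))"
    by (rule linearI) (simp_all add: prefix_add prefix_scaleR scaleR_add_left sum.distrib scaleR_sum_right)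
  show "T (prefix y) = y" if y: "y \<in> b ` {..<2 * n}" for y
  proof -
    obtain m where m: "y = b m" "m < 2 * n" using y by auto
    have "T (prefix y) = (\<Sum>j<2 * n. if j = m then b j else 0)"
      using m by (intro sum.cong) (auto simp: prefix_b)
    then show ?thesis using m by simp
  qed
qed

lemma inj_b: "inj_on b {..<2 * n}"
  by (rule inj_onI) (metis lessThan_iff prefix_b zero_neq_one)

lemma independent_b: "independent (b ` {..<2 * n})"
proof (rule independent_if_scalars_zero)
  fix f x assume "(\<Sum>x\<in>b ` {..<2 * n}. f x *\<^sub>R x) = 0" and "x \<in> b ` {..<2 * n}"
  then obtain m where m: "m < 2 * n" "x = b m" and T: "T (\<lambda>j. f (b j)) = 0"
    by (auto simp: sum.reindex[OF inj_b])
  then show "f x = 0" using prefix_T[of m "\<lambda>j. f (b j)"] by (simp add: T prefix_def)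
qed simp

section \<open>Edge vectors, affine hull and lattice frame\<close>

definition edge_pairs :: "('v \<times> 'v) set" where
  "edge_pairs = (\<Union>i<n. {(w (2 * i), w (2 * i + 2)), (w (2 * i), w (2 * i + 1)), (w (2 * i + 1), w (2 * i + 2))})
     \<union> {(w 0, w (2 * n))}"

definition edge_vectors :: "(real^'v) set" where
  "edge_vectors = (\<lambda>(x, y). axis x 1 - axis y 1) ` edge_pairs"

lemma sum_b: "(\<Sum>j<m. b j) = axis (w 0) 1 - axis (w m) 1"
  by (induction m) (simp_all add: b_def)

text \<open>Oriented along \<open>w\<close>, an edge of a triangle covers one or two steps of the
  path, and the closing edge covers all of them.\<close>

lemma edge_vectors_eq:
  "edge_vectors = b ` {..<2 * n} \<union> (\<lambda>i. b (2 * i) + b (2 * i + 1)) ` {..<n} \<union> {\<Sum>j<2 * n. b j}"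
proof -
  have "{..<2 * n} = (\<Union>i<n. {2 * i, 2 * i + 1})"
    using less_two_mult_iff by auto
  then have "b ` {..<2 * n} = (\<Union>i<n. {b (2 * i), b (2 * i + 1)})"
    by auto
  then show ?thesis
    unfolding edge_vectors_def edge_pairs_def sum_b by (auto simp: b_def)
qed

lemma Gamma_edges_eq: "Gamma_edges n u v = (\<lambda>(x, y). {x, y}) ` edge_pairs"
proof -
  have "{1..n} = Suc ` {..<n}"
    by (simp add: lessThan_atLeast0 image_Suc_atLeastLessThan atLeastLessThanSuc_atLeastAtMost)
  then show ?thesis
    unfolding Gamma_edges_def edge_pairs_def by (auto simp: w_def)
qed

lemma P_eq: "P = convex hull (edge_vectors \<union> uminus ` edge_vectors)"
proof -
  have "(\<Union>i. \<Union>j\<in>{j. {i, j} \<in> Gamma_edges n u v}. {axis i 1 - axis j 1, - (axis i 1 - axis j 1)}) =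
      edge_vectors \<union> uminus ` edge_vectors" (is "?A = _")
  proof
    show "?A \<subseteq> edge_vectors \<union> uminus ` edge_vectors"
    proof
      fix x assume "x \<in> ?A"
      then obtain i j where ij: "{i, j} \<in> Gamma_edges n u v"
        and x: "x = axis i 1 - axis j 1 \<or> x = - (axis i 1 - axis j 1)" by auto
      from ij obtain y z where yz: "(y, z) \<in> edge_pairs" "{i, j} = {y, z}"
        unfolding Gamma_edges_eq by auto
      have "axis y 1 - axis z 1 \<in> edge_vectors"
        unfolding edge_vectors_def using yz(1) by force
      \<comment> \<open>Reversing an edge negates its vector, and the symmetrized set contains
        both.\<close>
      moreover have "x = axis y 1 - axis z 1 \<or> x = - (axis y 1 - axis z 1)"
        using yz(2) x by (auto simp: doubleton_eq_iff)
      ultimately show "x \<in> edge_vectors \<union> uminus ` edge_vectors"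
        by (metis UnI1 UnI2 imageI)
    qed
    show "edge_vectors \<union> uminus ` edge_vectors \<subseteq> ?A"
      unfolding edge_vectors_def Gamma_edges_eq by force
  qed
  then show ?thesis unfolding symmetric_edge_polytope_def by simp
qed

lemma convex_P: "convex P"
  unfolding P_eq by (rule convex_convex_hull)

lemma P_borel: "P \<in> sets borel"
proof -
  have "finite edge_vectors" unfolding edge_vectors_def by simp
  then have "compact P"
    unfolding P_eq by (intro finite_imp_compact_convex_hull) simp
  then show ?thesis by (rule borel_compact)
qed

lemma edge_in_P:
  assumes "e \<in> edge_vectors"
  shows "e \<in> P" "- e \<in> P"
  unfolding P_eq using assms by (auto intro: hull_inc)

lemma b_in_edge_vectors:
  "j < 2 * n \<Longrightarrow> b j \<in> edge_vectors"
  "i < n \<Longrightarrow> b (2 * i) + b (2 * i + 1) \<in> edge_vectors"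
  "(\<Sum>j<2 * n. b j) \<in> edge_vectors"
  unfolding edge_vectors_eq by auto

lemma zero_in_P: "0 \<in> P"
proof -
  have "(1 / 2) *\<^sub>R b 0 + (1 / 2) *\<^sub>R (- b 0) \<in> P"
    using n by (intro convexD[OF convex_P] edge_in_P b_in_edge_vectors) auto
  then show ?thesis by simp
qed

lemma affine_hull_P: "affine hull P = span (b ` {..<2 * n})"
proof -
  have "affine hull P = span P"
    using zero_in_P by (intro affine_hull_span_0 hull_inc)
  also have "\<dots> = span (b ` {..<2 * n})"
  proof (rule span_eq[THEN iffD2], intro conjI)
    have "b j \<in> span (b ` {..<2 * n})" if "j < 2 * n" for j
      using that by (intro span_base) auto
    then have "edge_vectors \<subseteq> span (b ` {..<2 * n})"
      unfolding edge_vectors_eq by (auto intro!: span_add span_sum)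
    then have "edge_vectors \<union> uminus ` edge_vectors \<subseteq> span (b ` {..<2 * n})"
      by (auto intro: span_neg)
    then show "P \<subseteq> span (b ` {..<2 * n})"
      unfolding P_eq by (intro hull_minimal) (simp_all add: subspace_imp_convex)
    show "b ` {..<2 * n} \<subseteq> span P"
      using edge_in_P b_in_edge_vectors by (auto intro: span_base)
  qed
  finally show ?thesis .
qed

lemma aff_dim_P: "nat (aff_dim P) = 2 * n"
proof -
  have "aff_dim P = aff_dim (span (b ` {..<2 * n}))"
    by (metis aff_dim_affine_hull affine_hull_P)
  also have "\<dots> = int (dim (b ` {..<2 * n}))"
    by (simp add: aff_dim_subspace)
  also have "\<dots> = int (2 * n)"
    using independent_b inj_b by (simp add: dim_eq_card_independent card_image)
  finally show ?thesis by simp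
qed

lemma lattice_frame_P: "lattice_frame P 0 b"
proof -
  have "range (\<lambda>c :: nat \<Rightarrow> int. T (\<lambda>i. of_int (c i))) = integer_lattice \<inter> span (b ` {..<2 * n})"
  proof (intro equalityI subsetI)
    fix x assume "x \<in> range (\<lambda>c :: nat \<Rightarrow> int. T (\<lambda>i. of_int (c i)))"
    then obtain c :: "nat \<Rightarrow> int" where x: "x = T (\<lambda>i. of_int (c i))" by auto
    have "b i $ k \<in> \<int>" for i k by (simp add: b_def axis_def)
    then have "x \<in> integer_lattice"
      unfolding x integer_lattice_def by (auto intro!: Ints_sum Ints_mult)
    moreover have "x \<in> span (b ` {..<2 * n})"
      unfolding x by (intro span_sum span_scale span_base) simp
    ultimately show "x \<in> integer_lattice \<inter> span (b ` {..<2 * n})" by simp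
  next
    fix x assume x: "x \<in> integer_lattice \<inter> span (b ` {..<2 * n})"
    \<comment> \<open>Partial sums of integers are integers, so the \<open>b j\<close> generate
      every lattice point of the hyperplane and not just a sublattice of finite index.\<close>
    have "prefix x j \<in> \<int>" for j
      using x unfolding prefix_def integer_lattice_def by (intro Ints_sum) auto
    then have "x = T (\<lambda>j. of_int \<lfloor>prefix x j\<rfloor>)"
      using T_prefix[of x] x by simp
    then show "x \<in> range (\<lambda>c :: nat \<Rightarrow> int. T (\<lambda>i. of_int (c i)))"
      by (rule range_eqI[where x = "\<lambda>j. \<lfloor>prefix x j\<rfloor>"])
  qed
  then show ?thesis
    unfolding lattice_frame_def Let_def aff_dim_P affine_hull_P
    using inj_b independent_b by simp
qed

section \<open>Flows and the unit ball\<close>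

lemma flow_cost_edge:
  assumes "e \<in> edge_vectors"
  shows "\<exists>c. flow_cost n (prefix e) c \<le> 1"
proof -
  \<comment> \<open>An edge of triangle \<open>i\<close> is carried with \<open>c = 0\<close>. Its
    coordinates at \<open>2 * i\<close> and \<open>2 * i + 1\<close> are (1, 0), (0, 1) or (1, 1),
    each of cost \<open>1\<close>; all others vanish.\<close>
  have one: "flow_cost n s 0 = 1"
    if i: "i < n" and zero: "\<And>k. k < n \<Longrightarrow> k \<noteq> i \<Longrightarrow> s (2 * k) = 0 \<and> s (2 * k + 1) = 0"
      and two: "\<bar>s (2 * i)\<bar> + \<bar>s (2 * i + 1)\<bar> + \<bar>s (2 * i) - s (2 * i + 1)\<bar> = 2" for s i
  proof -
    have "(\<bar>0 - s (2 * k)\<bar> + \<bar>0 - s (2 * k + 1)\<bar> + \<bar>s (2 * k) - s (2 * k + 1)\<bar>) / 2 =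
        (if k = i then 1 else 0)" if "k < n" for k
      using two zero[OF that] by auto
    then have "flow_cost n s 0 = (\<Sum>k<n. if k = i then 1 else 0)"
      unfolding flow_cost_def by simp
    then show ?thesis using i by simp
  qed
  consider i where "i < n" "e = b (2 * i)" | i where "i < n" "e = b (2 * i + 1)"
    | i where "i < n" "e = b (2 * i) + b (2 * i + 1)" | "e = (\<Sum>j<2 * n. b j)"
    using assms unfolding edge_vectors_eq by (auto simp: less_two_mult_iff)
  then show ?thesis
  proof cases
    case 1
    then have "flow_cost n (prefix e) 0 = 1"
      by (intro one[of i]) (auto simp: prefix_b)
    then show ?thesis by (metis order_refl)
  next
    case 2
    then have "flow_cost n (prefix e) 0 = 1"
      by (intro one[of i]) (auto simp: prefix_b)
    then show ?thesis by (metis order_refl)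
  next
    case 3
    then have "flow_cost n (prefix e) 0 = 1"
      by (intro one[of i]) (auto simp: prefix_b prefix_add)
    then show ?thesis by (metis order_refl)
  next
    case 4
    \<comment> \<open>All coordinates of the closing edge are \<open>1\<close>; sending
      \<open>c = 1\<close> along it leaves nothing for the triangles.\<close>
    have "flow_cost n (prefix e) 1 = flow_cost n (\<lambda>_. 1) 1"
      using prefix_T[of _ "\<lambda>_. 1"] 4 by (intro flow_cost_cong) simp
    also have "\<dots> = 1" by (simp add: flow_cost_def)
    finally show ?thesis by (metis order_refl)
  qed
qed

text \<open>Forwards, the points of cost at most \<open>1\<close> form a convex set that contains
  the generators of \<open>P\<close>. Backwards, a flow of cost at most \<open>1\<close> writes
  \<open>T s\<close> as a combination of signed edge vectors of total weight at most
  \<open>1\<close>.\<close>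

lemma T_in_P_iff: "T s \<in> P \<longleftrightarrow> flow_gauge n s \<le> 1"
  unfolding flow_gauge_le_iff
proof
  define C where "C = {x. \<exists>c. flow_cost n (prefix x) c \<le> 1}"
  have "convex C"
  proof (rule convexI)
    fix x y and a a' :: real assume "x \<in> C" "y \<in> C" and a: "0 \<le> a" "0 \<le> a'" "a + a' = 1"
    then obtain c d where "flow_cost n (prefix x) c \<le> 1" "flow_cost n (prefix y) d \<le> 1"
      by (auto simp: C_def)
    then have "a * flow_cost n (prefix x) c + a' * flow_cost n (prefix y) d \<le> a * 1 + a' * 1"
      using a by (intro add_mono mult_left_mono)
    then have "flow_cost n (\<lambda>j. a * prefix x j + a' * prefix y j) (a * c + a' * d) \<le> 1"
      using flow_cost_convex[OF a(1,2), of n "prefix x" "prefix y" c d] a(3) by simp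
    moreover have "prefix (a *\<^sub>R x + a' *\<^sub>R y) = (\<lambda>j. a * prefix x j + a' * prefix y j)"
      by (simp add: fun_eq_iff prefix_add prefix_scaleR)
    ultimately show "a *\<^sub>R x + a' *\<^sub>R y \<in> C"
      by (auto simp: C_def)
  qed
  moreover have "edge_vectors \<union> uminus ` edge_vectors \<subseteq> C"
  proof
    fix x assume "x \<in> edge_vectors \<union> uminus ` edge_vectors"
    then consider "x \<in> edge_vectors" | e where "e \<in> edge_vectors" "x = - e" by auto
    then show "x \<in> C"
    proof cases
      case 1
      then show ?thesis using flow_cost_edge by (simp add: C_def)
    next
      case 2
      have "prefix x = (\<lambda>j. - prefix e j)" using 2 by (simp add: fun_eq_iff prefix_uminus)
      moreover obtain c where "flow_cost n (prefix e) c \<le> 1" using flow_cost_edge[OF 2(1)] by blast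
      ultimately have "flow_cost n (prefix x) (- c) \<le> 1" by (simp only: flow_cost_uminus)
      then show ?thesis by (auto simp: C_def)
    qed
  qed
  ultimately have "P \<subseteq> C" unfolding P_eq by (intro hull_minimal)
  moreover assume "T s \<in> P"
  ultimately obtain c where "flow_cost n (prefix (T s)) c \<le> 1" by (auto simp: C_def)
  then show "\<exists>c. flow_cost n s c \<le> 1"
    using flow_cost_cong[of n "prefix (T s)" s] prefix_T by auto
next
  assume "\<exists>c. flow_cost n s c \<le> 1"
  then obtain c where c: "flow_cost n s c \<le> 1" by blast
  let ?K = "\<lambda>r. (*\<^sub>R) r ` P"
  have scaled_edge: "r *\<^sub>R e \<in> ?K \<bar>r\<bar>" if "e \<in> edge_vectors" for r e
  proof (cases "r \<ge> 0")
    case True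
    then show ?thesis using edge_in_P(1)[OF that] by auto
  next
    case False
    then have "r *\<^sub>R e = \<bar>r\<bar> *\<^sub>R (- e)" by simp
    then show ?thesis using edge_in_P(2)[OF that] by blast
  qed
  note add = scaled_convex_add[OF convex_P]
  have pair: "x *\<^sub>R b (2 * i) + y *\<^sub>R b (2 * i + 1) \<in> ?K ((\<bar>x\<bar> + \<bar>y\<bar> + \<bar>x - y\<bar>) / 2)" if "i < n" for x y i
  proof -
    \<comment> \<open>\<open>m\<close> is the median of \<open>0\<close>, \<open>x\<close> and \<open>y\<close>: the amount sent along the edge \<open>u (i+1) u (i+2)\<close>.\<close>
    define m where "m = max (min x y) (min 0 (max x y))"
    have "m *\<^sub>R (b (2 * i) + b (2 * i + 1)) + ((x - m) *\<^sub>R b (2 * i) + (y - m) *\<^sub>R b (2 * i + 1))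
        \<in> ?K (\<bar>m\<bar> + (\<bar>x - m\<bar> + \<bar>y - m\<bar>))"
      using that by (intro add scaled_edge b_in_edge_vectors) auto
    moreover have "\<bar>m\<bar> + (\<bar>x - m\<bar> + \<bar>y - m\<bar>) = (\<bar>x\<bar> + \<bar>y\<bar> + \<bar>x - y\<bar>) / 2"
      by (auto simp: m_def max_def min_def)
    moreover have "m *\<^sub>R (b (2 * i) + b (2 * i + 1)) + ((x - m) *\<^sub>R b (2 * i) + (y - m) *\<^sub>R b (2 * i + 1)) =
        x *\<^sub>R b (2 * i) + y *\<^sub>R b (2 * i + 1)"
      by (simp add: algebra_simps)
    ultimately show ?thesis by simp
  qed
  define r where "r i = (\<bar>s (2 * i) - c\<bar> + \<bar>s (2 * i + 1) - c\<bar> + \<bar>s (2 * i) - c - (s (2 * i + 1) - c)\<bar>) / 2" for i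
  have cost: "\<bar>c\<bar> + (\<Sum>i<n. r i) = flow_cost n s c"
    unfolding flow_cost_def r_def by (simp add: abs_minus_commute)
  \<comment> \<open>The closing edge vector is the sum of all \<open>b j\<close>, so removing its
    flow lowers every coordinate by \<open>c\<close>.\<close>
  have "T s = c *\<^sub>R (\<Sum>j<2 * n. b j) + (\<Sum>j<2 * n. (s j - c) *\<^sub>R b j)"
    by (simp add: scaleR_sum_right sum.distrib[symmetric] scaleR_add_left[symmetric])
  also have "\<dots> \<in> ?K (\<bar>c\<bar> + (\<Sum>i<n. r i))"
  proof (intro add scaled_edge b_in_edge_vectors)
    show "(\<Sum>j<2 * n. (s j - c) *\<^sub>R b j) \<in> ?K (\<Sum>i<n. r i)"
      unfolding sum_pairs r_def using zero_in_P
      by (intro scaled_convex_sum[OF convex_P] pair) auto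
  qed (auto simp: r_def intro!: sum_nonneg)
  finally obtain x where x: "x \<in> P" "T s = flow_cost n s c *\<^sub>R x" unfolding cost by auto
  \<comment> \<open>The origin takes up the weight that is missing to \<open>1\<close>.\<close>
  have "flow_cost n s c *\<^sub>R x + (1 - flow_cost n s c) *\<^sub>R 0 \<in> P"
    using c x(1) zero_in_P abs_le_flow_cost[of c n s] by (intro convexD[OF convex_P]) auto
  then show "T s \<in> P" using x(2) by simp
qed

lemma normalized_volume_P:
  "normalized_volume P = real (2 ^ n * (\<Sum>k = 0..n. (k + 1) * (n choose k) * (k choose (k div 2))))"
proof -
  have "lattice_volume P = measure (PiM {..<2 * n} (\<lambda>_. lborel))
      {s \<in> space (PiM {..<2 * n} (\<lambda>_. lborel)). flow_gauge n s \<le> 1}"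
    unfolding lattice_volume_eq_frame_volume[OF lattice_frame_P P_borel] frame_volume_def Let_def aff_dim_P
    by (simp add: T_in_P_iff space_PiM)
  then show ?thesis
    unfolding normalized_volume_def aff_dim_P
    by (simp only: flow_gauge_volume spread_parts atLeast0AtMost)
qed

end

theorem corollary4p6:
  fixes n :: nat and u v :: "nat \<Rightarrow> 'v::finite"
  assumes "n \<ge> 1"
    and "inj_on u {1..n + 1}" and "inj_on v {1..n}"
    and "u ` {1..n + 1} \<inter> v ` {1..n} = {}"
    and "u ` {1..n + 1} \<union> v ` {1..n} = (UNIV :: 'v set)"
  shows "normalized_volume (symmetric_edge_polytope (Gamma_edges n u v)) =
    real (2 ^ n * (\<Sum>k = 0..n. (k + 1) * (n choose k) * (k choose (k div 2))))"
  using gamma_graph.normalized_volume_P[OF gamma_graph.intro[OF assms]] .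

end
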